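(* Consider $m$ leaders with positions $p_j^t(t)\in\mathbb{R}^2$, $\dot p_j^t=v_j$, $j\in\mathcal V_L=\{1,\dots,m\}$, and $n$ followers with positions $p_i(t)\in\mathbb{R}^2$, $\dot p_i=u_i$, $i\in\mathcal V_F=\{1,\dots,n\}$. Assume that: (1) the communication graph among the followers is undirected and connected, with weights $a_{ij}=a_{ji}\in\{0,1\}$; (2) each leader is observed by at least one follower, and followers observe only positions (not velocities) of their neighboring leaders; (3) there is a known constant $\beta>0$ with $\|v_j(t)\|_2\le\beta$ for all $j\in\mathcal V_L$ and all $t$. Let an admissible spacing pattern $(w_d,\rho_d,a)$, $a=[a_1,\dots,a_n]^T$, be given. Suppose each follower $i$ maintains the estimator $$r_i=\Phi_i+\tilde p_i,\qquad \tilde p_i=\frac{n}{m}\sum_{j\in N_i^T}\frac{1}{|N_j^F|}\,p_j^t,\qquad \dot\Phi_i=k_e\sum_{j\in N_i}a_{ij}\,(r_j-r_i)^{1/\alpha_1},$$ and applies the control input $$u_i=\varphi_i'\,w_{z,i}+\varphi_{i\perp}'\,w_{\delta,i}+\dot r_i,\qquad w_{z,i}=-k_z z_i^{1/\alpha_2},\qquad w_{\delta,i}=k_\delta\,\delta_i^{1/\alpha_3}+w_d,$$ where $k_e,k_z,k_\delta>0$ and $\alpha_l=p_l/q_l$ with $p_l>q_l>0$ odd integers, $l=1,2,3$. Then the origin of the dynamics of the estimated errors $z=[z_1,\dots,z_n]^T$ and $\delta=[\delta_1,\dots,\delta_n]^T$ is finite-time stable, i.e. there exist settling times $T_2,T_3$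 such that for all $i\in\mathcal V_F$ $$|\rho_i'(t)-\rho_d|=0\ \text{ for all } t>T_2,\qquad |\bar\theta_i'(t)-a_i|=0\ \text{ for all } t>T_3.$$
   Context: Superscript $t$ in $p_j^t$ and $\bar p^t$ is a label meaning "target" (leader). $\bar p^t=\frac1m\sum_{j\in\mathcal V_L}p_j^t$ is the leaders' average position. $N_i\subseteq\mathcal V_F$ is the set of neighboring followers of follower $i$ ($a_{ij}=1$ iff $j\in N_i$). $N_i^T\subseteq\mathcal V_L$ is the set of leaders observed by follower $i$ and $N_j^F\subseteq\mathcal V_F$ is the set of followers observing leader $j$; these sets do not change with time. (The double-indexed $a_{ij}$ are graph weights; the single-indexed $a_i$ are desired included angles.) Powers $x^{q/p}$ with $p,q$ odd are componentwise real odd-root powers. Admissible spacing pattern: desired rotation parameter $w_d>0$, desired included angles $a_i>0$ with $\sum_{i=1}^n a_i=2\pi$, and desired radius $\rho_d>\max_{j\in\mathcal V_L}\|p_j^t-\bar p^t\|_2$. Estimated quantities: $\Delta p_i'=p_i-r_i=[\Delta p_i'^x,\Delta p_i'^y]^T$, $\rho_i'=\|\Delta p_i'\|_2$ (assumed nonzero so that the controller is defined), $\varphi_i'=\Delta p_i'/\rho_i'$, $\varphi_{i\perp}'=[-\Delta p_i'^y,\Delta p_i'^x]^T/\rho_i'$. The angle $\theta_i'$ is the polar angle ($\mathrm{atan2}$) of $\Delta p_i'$. Each follower $i$ has a successor $i_+$: the followers are arranged in cyclic (counterclockwise) order around the center and $i_+$ is the next one. The estimated included angle is $\bar\theta_i'=\theta_{i_+}'-\theta_i'+\varsigma_i$,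 where $\varsigma_i=0$ if $\theta_{i_+}'-\theta_i'\ge0$ and $\varsigma_i=2\pi$ if $\theta_{i_+}'-\theta_i'<0$; hence $\sum_i\bar\theta_i'=2\pi$. The estimated errors are $z_i=\rho_i'-\rho_d$ and $\delta_i=\bar\theta_i'/a_i-1$, so that $\sum_i a_i\delta_i=0$. *)

theory Defs
  imports "HOL-Analysis.Analysis"
begin

text \<open>
  Followers and leaders are indexed by finite types \<open>'n\<close> and \<open>'m\<close>, so that
  $n$ is \<open>CARD('n)\<close> and $m$ is \<open>CARD('m)\<close>.  Time is \<open>{0..}\<close>; derivatives are taken within
  this set, hence one-sided at time 0.  Leader \<open>j\<close> has position \<open>pt j t\<close>; \<open>NT i\<close> is the set
  of leaders observed by follower \<open>i\<close>; \<open>A i j\<close> is the weight $a_{ij}$.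
\<close>

text \<open>The real power $x^{q/p}$ for odd \<open>p\<close> and \<open>q\<close>: for odd \<open>p\<close>, \<^const>\<open>root\<close> is the
  odd function inverse to $x \mapsto x^p$ on all of the reals.\<close>

definition odd_pow :: "nat \<Rightarrow> nat \<Rightarrow> real \<Rightarrow> real" where
  "odd_pow q p x = root p x ^ q"

definition odd_pow_vec :: "nat \<Rightarrow> nat \<Rightarrow> real ^ 'k \<Rightarrow> real ^ 'k" where
  "odd_pow_vec q p x = (\<chi> c. odd_pow q p (x $ c))"

definition nbrs :: "('n \<Rightarrow> 'n \<Rightarrow> real) \<Rightarrow> 'n \<Rightarrow> 'n set" where
  "nbrs A i = {j. A i j = 1}"

definition undirected_connected :: "('n \<Rightarrow> 'n \<Rightarrow> real) \<Rightarrow> bool" where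
  "undirected_connected A \<longleftrightarrow>
     (\<forall>i j. A i j \<in> {0, 1} \<and> A i j = A j i) \<and> (\<forall>i j. (i, j) \<in> {(x, y). y \<in> nbrs A x}\<^sup>*)"

definition observers :: "('n \<Rightarrow> 'm set) \<Rightarrow> 'm \<Rightarrow> 'n set" where
  "observers NT j = {i. j \<in> NT i}"

definition leader_average :: "('m::finite \<Rightarrow> real \<Rightarrow> real ^ 2) \<Rightarrow> real \<Rightarrow> real ^ 2" where
  "leader_average pt t = (1 / real CARD('m)) *\<^sub>R (\<Sum>j\<in>UNIV. pt j t)"

definition admissible_pattern ::
  "('m::finite \<Rightarrow> real \<Rightarrow> real ^ 2) \<Rightarrow> real \<Rightarrow> real \<Rightarrow> ('n::finite \<Rightarrow> real) \<Rightarrow> bool" where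
  "admissible_pattern pt wd rhod a \<longleftrightarrow>
     wd > 0 \<and> (\<forall>i. a i > 0) \<and> (\<Sum>i\<in>UNIV. a i) = 2 * pi \<and>
     (\<forall>t\<ge>0. rhod > Max (range (\<lambda>j. norm (pt j t - leader_average pt t))))"

definition observed_input ::
  "('n::finite \<Rightarrow> 'm::finite set) \<Rightarrow> ('m \<Rightarrow> real \<Rightarrow> real ^ 2) \<Rightarrow> 'n \<Rightarrow> real \<Rightarrow> real ^ 2" where
  "observed_input NT pt i t =
     (real CARD('n) / real CARD('m)) *\<^sub>R
       (\<Sum>j\<in>NT i. (1 / real (card (observers NT j))) *\<^sub>R pt j t)"

definition estimate ::
  "('n::finite \<Rightarrow> 'm::finite set) \<Rightarrow> ('m \<Rightarrow> real \<Rightarrow> real ^ 2) \<Rightarrow> ('n \<Rightarrow> real \<Rightarrow> real ^ 2)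
     \<Rightarrow> 'n \<Rightarrow> real \<Rightarrow> real ^ 2" where
  "estimate NT pt Phi i t = Phi i t + observed_input NT pt i t"

text \<open>Below, \<open>d i\<close> is the estimated relative position $\Delta p_i' = p_i - r_i$ at a fixed time.\<close>

definition radial_dir :: "real ^ 2 \<Rightarrow> real ^ 2" where
  "radial_dir x = (1 / norm x) *\<^sub>R x"

definition tangential_dir :: "real ^ 2 \<Rightarrow> real ^ 2" where
  "tangential_dir x = (1 / norm x) *\<^sub>R vector [- x $ 2, x $ 1]"

text \<open>\<^const>\<open>Arg\<close> takes values in the interval from $-\pi$ (excluded) to $\pi$ (included), as
  atan2 does.\<close>

definition polar_angle :: "real ^ 2 \<Rightarrow> real" where
  "polar_angle x = Arg (Complex (x $ 1) (x $ 2))"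

definition included_angle :: "('n \<Rightarrow> 'n) \<Rightarrow> ('n \<Rightarrow> real ^ 2) \<Rightarrow> 'n \<Rightarrow> real" where
  "included_angle succ d i =
     (let \<Delta> = polar_angle (d (succ i)) - polar_angle (d i)
      in \<Delta> + (if \<Delta> \<ge> 0 then 0 else 2 * pi))"

text \<open>
  The successor map enumerates the followers in counterclockwise order: they can be listed by
  nondecreasing polar angle in such a way that each one is followed by its successor, the last
  one by the first.  Some (but not all) followers may share the same polar angle.  Excluding
  the case that all angles agree is exactly what makes the included angles sum up to $2\pi$,
  see \<open>sum_included_angle\<close>.
\<close>

definition ccw_arranged :: "('n::finite \<Rightarrow> 'n) \<Rightarrow> ('n \<Rightarrow> real ^ 2) \<Rightarrow> bool" where
  "ccw_arranged succ d \<longleftrightarrow>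
     (\<exists>e. bij_betw e {..<CARD('n)} UNIV \<and>
          (\<forall>k<CARD('n). succ (e k) = e (Suc k mod CARD('n))) \<and>
          (\<forall>l<CARD('n). \<forall>k<l. polar_angle (d (e k)) \<le> polar_angle (d (e l)))) \<and>
     (\<exists>i j. polar_angle (d i) \<noteq> polar_angle (d j))"

definition radius_error :: "real \<Rightarrow> ('n \<Rightarrow> real ^ 2) \<Rightarrow> 'n \<Rightarrow> real" where
  "radius_error rhod d i = norm (d i) - rhod"

definition angle_error :: "('n \<Rightarrow> real) \<Rightarrow> ('n \<Rightarrow> 'n) \<Rightarrow> ('n \<Rightarrow> real ^ 2) \<Rightarrow> 'n \<Rightarrow> real" where
  "angle_error a succ d i = included_angle succ d i / a i - 1"

text \<open>
  A solution on \<open>{0..}\<close> of the closed loop formed by the estimators (with states \<open>Phi\<close>) and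
  the controlled followers (with positions \<open>p\<close>).  The term $\dot r_i$ of the control input is
  the time derivative of the estimate.
\<close>

definition closed_loop ::
  "('n::finite \<Rightarrow> 'n \<Rightarrow> real) \<Rightarrow> ('n \<Rightarrow> 'm::finite set) \<Rightarrow> ('m \<Rightarrow> real \<Rightarrow> real ^ 2)
    \<Rightarrow> real \<Rightarrow> real \<Rightarrow> real \<Rightarrow> nat \<Rightarrow> nat \<Rightarrow> nat \<Rightarrow> nat \<Rightarrow> nat \<Rightarrow> nat
    \<Rightarrow> real \<Rightarrow> real \<Rightarrow> ('n \<Rightarrow> real) \<Rightarrow> ('n \<Rightarrow> 'n)
    \<Rightarrow> ('n \<Rightarrow> real \<Rightarrow> real ^ 2) \<Rightarrow> ('n \<Rightarrow> real \<Rightarrow> real ^ 2) \<Rightarrow> bool" where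
  "closed_loop A NT pt ke kz kd p1 q1 p2 q2 p3 q3 wd rhod a succ Phi p \<longleftrightarrow>
     (\<forall>t\<ge>0.
        let r = estimate NT pt Phi;
            d = (\<lambda>i. p i t - r i t);
            wz = (\<lambda>i. - kz * odd_pow q2 p2 (radius_error rhod d i));
            w\<delta> = (\<lambda>i. kd * odd_pow q3 p3 (angle_error a succ d i) + wd)
        in (\<forall>i. d i \<noteq> 0) \<and> ccw_arranged succ d \<and>
           (\<forall>i. (Phi i has_vector_derivative
                   ke *\<^sub>R (\<Sum>j\<in>nbrs A i. A i j *\<^sub>R odd_pow_vec q1 p1 (r j t - r i t)))
                 (at t within {0..})) \<and>
           (\<forall>i. (p i has_vector_derivative
                   (wz i *\<^sub>R radial_dir (d i) + w\<delta> i *\<^sub>R tangential_dir (d i)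
                    + vector_derivative (r i) (at t within {0..})))
                 (at t within {0..})))"

definition error_traj ::
  "('n::finite \<Rightarrow> 'm::finite set) \<Rightarrow> ('m \<Rightarrow> real \<Rightarrow> real ^ 2) \<Rightarrow> real \<Rightarrow> ('n \<Rightarrow> real) \<Rightarrow> ('n \<Rightarrow> 'n)
    \<Rightarrow> ('n \<Rightarrow> real \<Rightarrow> real ^ 2) \<Rightarrow> ('n \<Rightarrow> real \<Rightarrow> real ^ 2) \<Rightarrow> real \<Rightarrow> (real ^ 'n) \<times> (real ^ 'n)" where
  "error_traj NT pt rhod a succ Phi p t =
     (let d = (\<lambda>i. p i t - estimate NT pt Phi i t)
      in (\<chi> i. radius_error rhod d i, \<chi> i. angle_error a succ d i))"

text \<open>
  Finite-time stability of the origin for a system given by the set of its trajectories on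
  \<open>{0..}\<close>: Lyapunov stability, together with convergence of every trajectory to the
  origin in finite time.
\<close>

definition finite_time_stable_origin :: "(real \<Rightarrow> 'e::real_normed_vector) set \<Rightarrow> bool" where
  "finite_time_stable_origin S \<longleftrightarrow>
     (\<forall>\<epsilon>>0. \<exists>\<eta>>0. \<forall>x\<in>S. norm (x 0) < \<eta> \<longrightarrow> (\<forall>t\<ge>0. norm (x t) < \<epsilon>)) \<and>
     (\<forall>x\<in>S. \<exists>T\<ge>0. \<forall>t>T. x t = 0)"

lemma sum_included_angle:
  fixes succ :: "'n::finite \<Rightarrow> 'n"
  assumes "ccw_arranged succ d"
  shows "(\<Sum>i\<in>UNIV. included_angle succ d i) = 2 * pi"
proof -
  define \<theta> where "\<theta> i = polar_angle (d i)" for i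
  obtain e where bij: "bij_betw e {..<CARD('n)} UNIV"
    and succ: "\<And>k. k < CARD('n) \<Longrightarrow> succ (e k) = e (Suc k mod CARD('n))"
    and mono: "\<And>k l. l < CARD('n) \<Longrightarrow> k < l \<Longrightarrow> \<theta> (e k) \<le> \<theta> (e l)"
    using assms unfolding ccw_arranged_def \<theta>_def by blast
  obtain i j where ij: "\<theta> i \<noteq> \<theta> j"
    using assms unfolding ccw_arranged_def \<theta>_def by blast
  obtain N where N: "CARD('n) = Suc N"
    using not0_implies_Suc by force
  have mono': "\<theta> (e k) \<le> \<theta> (e l)" if "l \<le> N" "k \<le> l" for k l
    using mono[of l k] that N by (cases "k = l") auto
  have lt: "\<theta> (e 0) < \<theta> (e N)"
  proof (rule ccontr)
    assume "\<not> \<theta> (e 0) < \<theta> (e N)"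
    then have eq: "\<theta> (e k) = \<theta> (e 0)" if "k \<le> N" for k
      using mono'[of k 0] mono'[of N k] that by simp
    obtain k l where "i = e k" "j = e l" "k \<le> N" "l \<le> N"
      using bij N unfolding bij_betw_def by (metis UNIV_I imageE lessThan_iff less_Suc_eq_le)
    then show False using ij eq by metis
  qed
  have "(\<Sum>i\<in>UNIV. included_angle succ d i) = (\<Sum>k<Suc N. included_angle succ d (e k))"
    using sum.reindex_bij_betw[OF bij, of "included_angle succ d"] N by simp
  also have "\<dots> = (\<Sum>k<N. included_angle succ d (e k)) + included_angle succ d (e N)"
    by simp
  also have "(\<Sum>k<N. included_angle succ d (e k)) = (\<Sum>k<N. \<theta> (e (Suc k)) - \<theta> (e k))"
  proof (rule sum.cong[OF refl])
    fix k assume "k \<in> {..<N}"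
    then have "succ (e k) = e (Suc k)" "\<theta> (e k) \<le> \<theta> (e (Suc k))"
      using succ[of k] mono'[of "Suc k" k] N by auto
    then show "included_angle succ d (e k) = \<theta> (e (Suc k)) - \<theta> (e k)"
      unfolding included_angle_def \<theta>_def by simp
  qed
  also have "\<dots> = \<theta> (e N) - \<theta> (e 0)"
    by (rule sum_lessThan_telescope)
  also have "included_angle succ d (e N) = \<theta> (e 0) - \<theta> (e N) + 2 * pi"
    using succ[of N] N lt unfolding included_angle_def \<theta>_def by simp
  finally show ?thesis by simp
qed

end

theory Submission
  imports Defs
begin

text \<open>
  The term $\dot r_i$ in the control input removes the motion of the estimate, so the relative
  position $p_i - r_i$ has radial speed $w_{z,i}$ and tangential speed $w_{\delta,i}$. Hence the
  radius error obeys the scalar equation $\dot z_i = -k_z z_i^{1/\alpha_2}$, and the polar angle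
  turns with the velocity $w_{\delta,i}/\rho_i'$ (\<open>closed_loop_error_dynamics\<close>).

  The square of $z_i$ satisfies $\dot V = -c V^\mu$ with $\mu < 1$ and therefore vanishes after
  a finite time that depends only on $|z_i(0)|$ and tends to zero with it (\<open>finite_time_decay\<close>,
  \<open>radius_error_eq_0\<close>). From then on all radii equal $\rho_d$, and
  $a_i \dot\delta_i = (k_\delta/\rho_d)(g(\delta_{i_+}) - g(\delta_i))$ with $g(x) = x^{1/\alpha_3}$.
  This is a nonlinear consensus protocol on a directed cycle. Its Lyapunov function is
  $\sum_i a_i |\delta_i|^{1+1/\alpha_3}$, and its derivative is a negative multiple of
  $\sum_i (g(\delta_{i_+}) - g(\delta_i))^2$ because the squares of the $g(\delta_i)$ telescope around
  the cycle. The constraint $\sum_i a_i\delta_i = 0$ bounds this sum below by a power with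
  exponent less than one of the Lyapunov function (\<open>dissipation_lower_bound\<close>), which again gives
  extinction in finite time (\<open>angle_errors_vanish\<close>).

  For Lyapunov stability the transient before the radii have settled has to be controlled. If
  the initial errors are small, the radii stay above $\rho_d/2$, so the angle errors move at a
  bounded speed, and they do so only for a short time (\<open>angle_error_le_bound\<close>).

  It is not obvious that the included angles are differentiable, or even continuous: an included
  angle could jump between 0 and $2\pi$ when a follower is overtaken. Since the included angles
  always sum to $2\pi$, all the others would then tend to zero, and all followers would end up in
  the same direction, which contradicts the cyclic arrangement
  (\<open>continuous_Arg2pi_of_sum_2pi\<close>, \<open>has_real_derivative_included_angle\<close>).
\<close>

section \<open>Finite-time decay of a Lyapunov function\<close>

lemma increment_le_of_derivative_le:
  fixes f :: "real \<Rightarrow> real"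
  assumes deriv: "\<And>t. t \<ge> s \<Longrightarrow> (f has_real_derivative f' t) (at t within {s..})"
    and bound: "\<And>t. s \<le> t \<Longrightarrow> t \<le> y \<Longrightarrow> f' t \<le> c"
    and "s \<le> x" "x \<le> y"
  shows "f y - f x \<le> c * (y - x)"
proof -
  have "\<exists>\<xi>\<in>{x..y}. f y - f x = f' \<xi> * (y - x)"
  proof (rule mvt_very_simple[OF \<open>x \<le> y\<close>])
    fix t assume "x \<le> t" "t \<le> y"
    then have "(f has_real_derivative f' t) (at t within {x..y})"
      using deriv[of t] \<open>s \<le> x\<close> by (auto intro: DERIV_subset)
    then show "(f has_derivative (*) (f' t)) (at t within {x..y})"
      by (simp add: has_field_derivative_def)
  qed
  then obtain \<xi> where "\<xi> \<in> {x..y}" "f y - f x = f' \<xi> * (y - x)" by blast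
  then show ?thesis
    using bound[of \<xi>] assms(3,4) by (auto intro: mult_right_mono)
qed

text \<open>
  As long as \<open>V\<close> is positive, $V^{1-\mu}$ has derivative at most $-c(1-\mu)$, so this power, and with
  it \<open>V\<close>, reaches zero no later than the root of the corresponding linear bound.
\<close>

lemma finite_time_decay:
  fixes V V' :: "real \<Rightarrow> real"
  assumes deriv: "\<And>t. t \<ge> s \<Longrightarrow> (V has_real_derivative V' t) (at t within {s..})"
    and decay: "\<And>t. t \<ge> s \<Longrightarrow> V' t \<le> - c * V t powr \<mu>"
    and nonneg: "\<And>t. t \<ge> s \<Longrightarrow> V t \<ge> 0"
    and "c > 0" "\<mu> < 1"
    and late: "t \<ge> s + V s powr (1 - \<mu>) / (c * (1 - \<mu>))"
  shows "V t = 0"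
proof (rule ccontr)
  assume "V t \<noteq> 0"
  have "0 \<le> V s powr (1 - \<mu>) / (c * (1 - \<mu>))"
    using assms(4,5) by simp
  with late have "s \<le> t" by linarith
  with \<open>V t \<noteq> 0\<close> have "V t > 0" using nonneg[of t] by simp
  have V'_nonpos: "V' x \<le> 0" if "s \<le> x" for x
    using decay[OF that] \<open>c > 0\<close> by (smt (verit) mult_minus_left mult_nonneg_nonneg powr_ge_zero)
  \<comment> \<open>As \<open>V\<close> does not increase, a positive value at \<open>t\<close> forces positive values before, where
    the power $V^{1-\mu}$ is differentiable.\<close>
  have pos: "V x > 0" if "s \<le> x" "x \<le> t" for x
    using increment_le_of_derivative_le[OF deriv, of t 0 x] V'_nonpos that \<open>V t > 0\<close> by auto
  have deriv_t: "(V has_real_derivative V' x) (at x within {s..t})" if "s \<le> x" for x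
    by (rule DERIV_subset[OF deriv[OF that]]) auto
  have "\<exists>\<xi>\<in>{s..t}. V t powr (1 - \<mu>) - V s powr (1 - \<mu>)
          = ((1 - \<mu>) * V \<xi> powr (- \<mu>) * V' \<xi>) * (t - s)"
  proof (rule mvt_very_simple[OF \<open>s \<le> t\<close>])
    fix x assume x: "s \<le> x" "x \<le> t"
    have "((\<lambda>y. y powr (1 - \<mu>)) has_real_derivative (1 - \<mu>) * V x powr (- \<mu>)) (at (V x))"
      using has_real_derivative_powr[OF pos[OF x], of "1 - \<mu>"] by simp
    from DERIV_chain2[OF this deriv_t[OF x(1)]]
    show "((\<lambda>x. V x powr (1 - \<mu>)) has_derivative (*) ((1 - \<mu>) * V x powr (- \<mu>) * V' x))
        (at x within {s..t})"
      by (simp add: has_field_derivative_def)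
  qed
  then obtain \<xi> where \<xi>: "s \<le> \<xi>" "\<xi> \<le> t"
    and eq: "V t powr (1 - \<mu>) - V s powr (1 - \<mu>)
          = ((1 - \<mu>) * V \<xi> powr (- \<mu>) * V' \<xi>) * (t - s)" by auto
  have "V \<xi> powr (- \<mu>) * V' \<xi> \<le> V \<xi> powr (- \<mu>) * (- c * V \<xi> powr \<mu>)"
    by (rule mult_left_mono[OF decay[OF \<xi>(1)]]) simp
  also have "\<dots> = - c"
    using pos[OF \<xi>] by (simp add: powr_minus field_simps)
  finally have "(1 - \<mu>) * (V \<xi> powr (- \<mu>) * V' \<xi>) \<le> (1 - \<mu>) * (- c)"
    using \<open>\<mu> < 1\<close> by (intro mult_left_mono) auto
  then have "((1 - \<mu>) * V \<xi> powr (- \<mu>) * V' \<xi>) * (t - s) \<le> ((1 - \<mu>) * (- c)) * (t - s)"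
    using \<open>s \<le> t\<close> by (intro mult_right_mono) (auto simp: mult.assoc)
  with eq have "V t powr (1 - \<mu>) \<le> V s powr (1 - \<mu>) - c * (1 - \<mu>) * (t - s)"
    by (simp add: algebra_simps)
  moreover have "V s powr (1 - \<mu>) \<le> c * (1 - \<mu>) * (t - s)"
  proof -
    have "V s powr (1 - \<mu>) / (c * (1 - \<mu>)) \<le> t - s" using late by linarith
    moreover have "c * (1 - \<mu>) > 0" using \<open>c > 0\<close> \<open>\<mu> < 1\<close> by simp
    ultimately show ?thesis by (simp only: pos_divide_le_eq mult.commute)
  qed
  ultimately have "V t powr (1 - \<mu>) \<le> 0" by linarith
  then show False using \<open>V t > 0\<close> by simp
qed

section \<open>Signed powers\<close>

definition sgn_powr :: "real \<Rightarrow> real \<Rightarrow> real" where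
  "sgn_powr \<gamma> x = sgn x * \<bar>x\<bar> powr \<gamma>"

text \<open>
  The two odd exponents matter only through their quotient, so that the error dynamics can be
  studied for an arbitrary real exponent.
\<close>

lemma odd_pow_eq_sgn_powr:
  assumes "odd p" "odd q" "0 < q"
  shows "odd_pow q p x = sgn_powr (real q / real p) x"
proof -
  have "p > 0" using \<open>odd p\<close> by (auto intro: odd_pos)
  have pos: "root p y ^ q = y powr (real q / real p)" if "y > 0" for y
  proof -
    have "root p y ^ q = (y powr (1 / real p)) powr real q"
      using that \<open>p > 0\<close> by (simp add: root_powr_inverse powr_realpow)
    then show ?thesis by (simp add: powr_powr)
  qed
  consider "x = 0" | "x > 0" | "x < 0" by linarith
  then show ?thesis
  proof cases
    case 3
    have "root p x ^ q = - (root p (- x) ^ q)"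
      using \<open>odd q\<close> by (simp add: real_root_minus)
    then show ?thesis using pos[of "- x"] 3 by (simp add: odd_pow_def sgn_powr_def)
  qed (use pos[of x] assms in \<open>auto simp: odd_pow_def sgn_powr_def\<close>)
qed

lemma abs_sgn_powr: "\<bar>sgn_powr \<gamma> x\<bar> = \<bar>x\<bar> powr \<gamma>"
  by (cases "x = 0") (auto simp: sgn_powr_def abs_mult)

lemma mult_sgn_powr: "x * sgn_powr \<gamma> x = \<bar>x\<bar> powr (1 + \<gamma>)"
  by (cases "x = 0") (auto simp: sgn_powr_def powr_add sgn_if abs_if)

lemma power2_powr_half: "(x\<^sup>2) powr (c / 2) = \<bar>x :: real\<bar> powr c"
proof -
  have "x\<^sup>2 = \<bar>x\<bar> powr 2" by (cases "x = 0") simp_all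
  then show ?thesis by (simp only: powr_powr) simp
qed

text \<open>
  The point of interest is the origin, where the power function itself has no derivative
  rule: there the difference quotient of $|x|^{1+\gamma}$ is the signed power with
  exponent \<open>\<gamma>\<close>, which tends to zero.
\<close>

lemma has_real_derivative_abs_powr:
  assumes "\<gamma> > 0"
  shows "((\<lambda>x. \<bar>x\<bar> powr (1 + \<gamma>)) has_real_derivative (1 + \<gamma>) * sgn_powr \<gamma> x) (at x)"
proof -
  consider "x = 0" | "x > 0" | "x < 0" by linarith
  then show ?thesis
  proof cases
    case 1
    have "((\<lambda>h. sgn_powr \<gamma> h) \<longlongrightarrow> 0) (at 0)"
    proof (rule tendsto_rabs_zero_cancel)
      have "((\<lambda>h. \<bar>h\<bar> powr \<gamma>) \<longlongrightarrow> \<bar>0\<bar> powr \<gamma>) (at (0::real))"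
        using assms by (intro tendsto_powr' tendsto_rabs tendsto_ident_at tendsto_const) auto
      then show "((\<lambda>h. \<bar>sgn_powr \<gamma> h\<bar>) \<longlongrightarrow> 0) (at 0)"
        by (simp add: abs_sgn_powr)
    qed
    then have "((\<lambda>h. \<bar>h\<bar> powr (1 + \<gamma>) / h) \<longlongrightarrow> 0) (at 0)"
    proof (rule Lim_transform_eventually)
      show "\<forall>\<^sub>F h in at 0. sgn_powr \<gamma> h = \<bar>h\<bar> powr (1 + \<gamma>) / h"
        using eventually_neq_at_within[of 0 0 UNIV]
        by eventually_elim (simp flip: mult_sgn_powr)
    qed
    then show ?thesis
      using 1 assms by (simp add: DERIV_def sgn_powr_def)
  next
    case 2
    have "((\<lambda>x. x powr (1 + \<gamma>)) has_real_derivative (1 + \<gamma>) * sgn_powr \<gamma> x) (at x)"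
      using has_real_derivative_powr[OF 2, of "1 + \<gamma>"] 2 by (simp add: sgn_powr_def)
    then show ?thesis
      by (rule has_field_derivative_transform_within_open[where S = "{0<..}"]) (use 2 in auto)
  next
    case 3
    have "((\<lambda>x. (- x) powr (1 + \<gamma>)) has_real_derivative (1 + \<gamma>) * sgn_powr \<gamma> x) (at x)"
      using 3 by (auto intro!: derivative_eq_intros simp: sgn_powr_def)
    then show ?thesis
      by (rule has_field_derivative_transform_within_open[where S = "{..<0}"]) (use 3 in auto)
  qed
qed

section \<open>Cyclic successor maps\<close>

text \<open>
  The part of \<^const>\<open>ccw_arranged\<close> that does not depend on the positions: the successor map
  consists of a single cycle.
\<close>

definition cyclic_successor :: "('n::finite \<Rightarrow> 'n) \<Rightarrow> bool" where
  "cyclic_successor succ \<longleftrightarrow>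
     (\<exists>e. bij_betw e {..<CARD('n)} UNIV \<and>
          (\<forall>k<CARD('n). succ (e k) = e (Suc k mod CARD('n))))"

lemma bij_cyclic_successor:
  fixes succ :: "'n::finite \<Rightarrow> 'n"
  assumes "cyclic_successor succ"
  shows "bij succ"
proof -
  obtain e where e: "bij_betw e {..<CARD('n)} (UNIV :: 'n set)"
    and succ: "\<And>k. k < CARD('n) \<Longrightarrow> succ (e k) = e (Suc k mod CARD('n))"
    using assms unfolding cyclic_successor_def by blast
  have "\<exists>i. succ i = j" for j
  proof -
    obtain k where k: "k < CARD('n)" "j = e k"
      using e unfolding bij_betw_def by (metis UNIV_I imageE lessThan_iff)
    show ?thesis
    proof (cases k)
      case 0
      then show ?thesis using succ[of "CARD('n) - 1"] k by (auto simp: Suc_diff_1)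
    next
      case (Suc l)
      then show ?thesis using succ[of l] k by auto
    qed
  qed
  then have "surj succ" by (metis surjI)
  then show ?thesis by (simp add: bij_def finite_UNIV_surj_inj)
qed

lemma sum_cyclic_successor:
  fixes succ :: "'n::finite \<Rightarrow> 'n"
  assumes "cyclic_successor succ"
  shows "(\<Sum>i\<in>UNIV. f (succ i)) = (\<Sum>i\<in>UNIV. f i)"
  using sum.reindex_bij_betw[of succ UNIV UNIV f] bij_cyclic_successor[OF assms]
  by (simp add: bij_def bij_betw_def)

text \<open>
  Walking from one index to the other along the cycle passes each step at most once. This is
  how a spread of the angle errors is turned into a lower bound for the differences of
  neighbours.
\<close>

lemma cyclic_variation:
  fixes succ :: "'n::finite \<Rightarrow> 'n" and f :: "'n \<Rightarrow> real"
  assumes "cyclic_successor succ"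
  shows "\<bar>f i - f j\<bar> \<le> (\<Sum>k\<in>UNIV. \<bar>f (succ k) - f k\<bar>)"
proof -
  obtain e where e: "bij_betw e {..<CARD('n)} (UNIV :: 'n set)"
    and succ: "\<And>k. k < CARD('n) \<Longrightarrow> succ (e k) = e (Suc k mod CARD('n))"
    using assms unfolding cyclic_successor_def by blast
  let ?h = "\<lambda>l. \<bar>f (succ (e l)) - f (e l)\<bar>"
  have ordered: "\<bar>f (e l) - f (e k)\<bar> \<le> (\<Sum>k\<in>UNIV. \<bar>f (succ k) - f k\<bar>)"
    if "k \<le> l" "l < CARD('n)" for k l
  proof -
    have "f (e l) - f (e k) = (\<Sum>x=k..<l. f (e (Suc x)) - f (e x))"
      using sum_Suc_diff'[OF that(1), of "\<lambda>x. f (e x)"] by simp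
    also have "\<dots> = (\<Sum>x=k..<l. f (succ (e x)) - f (e x))"
      using that(2) by (intro sum.cong) (auto simp: succ)
    finally have "\<bar>f (e l) - f (e k)\<bar> \<le> (\<Sum>x=k..<l. ?h x)"
      by (simp add: sum_abs)
    also have "\<dots> \<le> (\<Sum>x<CARD('n). ?h x)"
      using that(2) by (intro sum_mono2) auto
    also have "\<dots> = (\<Sum>k\<in>UNIV. \<bar>f (succ k) - f k\<bar>)"
      using sum.reindex_bij_betw[OF e, of "\<lambda>k. \<bar>f (succ k) - f k\<bar>"] .
    finally show ?thesis .
  qed
  obtain k where k: "k < CARD('n)" "i = e k"
    using e unfolding bij_betw_def by (metis UNIV_I imageE lessThan_iff)
  obtain l where l: "l < CARD('n)" "j = e l"
    using e unfolding bij_betw_def by (metis UNIV_I imageE lessThan_iff)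
  show ?thesis
    using ordered[of k l] ordered[of l k] k l by (cases "k \<le> l") (auto simp: abs_minus_commute)
qed

section \<open>The decoupled error dynamics\<close>

text \<open>
  The constants of the pattern and of the controller are kept apart from the trajectories:
  Lyapunov stability asks for one \<open>\<eta>\<close> that serves all trajectories, so every bound below is
  built from these constants only. \<open>R\<close> is the desired radius, and \<open>\<gamma>\<close> and \<open>\<kappa>\<close> are the exponents
  of the radial and the angular feedback.
\<close>

locale formation_parameters =
  fixes succ :: "'n::finite \<Rightarrow> 'n" and a :: "'n \<Rightarrow> real"
    and kz kd wd R \<gamma> \<kappa> :: real
  assumes cyclic: "cyclic_successor succ"
    and a_pos: "a i > 0" and sum_a: "(\<Sum>i\<in>UNIV. a i) = 2 * pi"
    and gains: "kz > 0" "kd > 0" and wd_pos: "wd > 0" and R_pos: "R > 0"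
    and \<gamma>: "0 < \<gamma>" "\<gamma> < 1" and \<kappa>: "0 < \<kappa>" "\<kappa> < 1"
begin

text \<open>
  After this time every radius error of initial size at most \<open>r\<close> has vanished; see
  \<open>radius_error_eq_0\<close>.
\<close>

definition settling_time :: "real \<Rightarrow> real" where
  "settling_time r = r powr (1 - \<gamma>) / (kz * (1 - \<gamma>))"

definition angle_error_range :: real where
  "angle_error_range = (\<Sum>i\<in>UNIV. 1 + 2 * pi / a i)"

text \<open>
  A bound on the speed of the angle errors while all radii are at least half the desired one.
  A single angular velocity is at most $2(k_\delta D^\kappa + w_d)/R$, where \<open>D\<close> bounds the angle
  errors, and the speed of an error involves two of them.
\<close>

definition drift_rate :: real where
  "drift_rate = (\<Sum>i\<in>UNIV. 4 * (kd * angle_error_range powr \<kappa> + wd) / (R * a i))"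

text \<open>
  The price for passing from the maximum of the angle errors to the energy and back.
\<close>

definition amplification :: real where
  "amplification = (\<Sum>i\<in>UNIV. 2 * pi / a i)"

definition angle_bound :: "real \<Rightarrow> real" where
  "angle_bound r = amplification * (r + drift_rate * settling_time r)"

lemma a_le_2pi: "a i \<le> 2 * pi"
  using member_le_sum[of i UNIV a] a_pos sum_a by (simp add: less_imp_le)

lemma drift_rate_nonneg: "drift_rate \<ge> 0"
  unfolding drift_rate_def using a_pos R_pos gains wd_pos
  by (intro sum_nonneg divide_nonneg_nonneg mult_nonneg_nonneg add_nonneg_nonneg)
    (auto simp: less_imp_le)

lemma settling_time_nonneg: "settling_time r \<ge> 0"
  unfolding settling_time_def using gains \<gamma> by auto

lemma ratio_le_amplification: "2 * pi / a i \<le> amplification"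
  unfolding amplification_def
  by (rule member_le_sum) (use a_pos in \<open>auto simp: less_imp_le\<close>)

lemma amplification_ge_1: "amplification \<ge> 1"
proof -
  fix i :: 'n
  have "1 \<le> 2 * pi / a i" using a_le_2pi[of i] a_pos[of i] by simp
  then show ?thesis using ratio_le_amplification[of i] by linarith
qed

text \<open>
  Small initial errors leave little time for the angle errors to drift: this is where
  $\gamma < 1$ makes the settling time tend to zero with the initial error.
\<close>

lemma angle_bound_tendsto_0: "(angle_bound \<longlongrightarrow> 0) (at_right 0)"
proof -
  have "((\<lambda>r. amplification * (r + drift_rate * (r powr (1 - \<gamma>) / (kz * (1 - \<gamma>)))))
      \<longlongrightarrow> amplification * (0 + drift_rate * (0 powr (1 - \<gamma>) / (kz * (1 - \<gamma>))))) (at_right 0)"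
    using \<gamma> gains
    by (intro tendsto_intros tendsto_powr') (auto simp: eventually_at_right_less less_imp_le
        intro: eventually_mono[OF eventually_at_right_less])
  then show ?thesis by (simp add: angle_bound_def[abs_def] settling_time_def)
qed

text \<open>
  Up to a constant this is $\sum_i a_i \int_0^{\delta_i} g$ for the angular feedback \<open>g\<close>. The
  weights $a_i$ cancel the factors $1/a_i$ in the dynamics of $\delta_i$, which makes the
  derivative of the energy a sum over the cycle of $g(\delta_i)(g(\delta_{i_+}) - g(\delta_i))$.
\<close>

definition angle_energy :: "('n \<Rightarrow> real) \<Rightarrow> real" where
  "angle_energy \<delta> = (\<Sum>i\<in>UNIV. a i * \<bar>\<delta> i\<bar> powr (1 + \<kappa>))"

lemma angle_energy_nonneg: "angle_energy \<delta> \<ge> 0"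
  unfolding angle_energy_def using a_pos by (auto intro!: sum_nonneg simp: less_imp_le)

lemma angle_energy_le:
  assumes "\<And>i. \<bar>\<delta> i\<bar> \<le> M"
  shows "angle_energy \<delta> \<le> 2 * pi * M powr (1 + \<kappa>)"
proof -
  have "angle_energy \<delta> \<le> (\<Sum>i\<in>UNIV. a i * M powr (1 + \<kappa>))"
    unfolding angle_energy_def using a_pos \<kappa> assms
    by (intro sum_mono mult_left_mono powr_mono2) (auto simp: less_imp_le)
  then show ?thesis by (simp add: sum_a flip: sum_distrib_right)
qed

lemma le_of_angle_energy_le:
  assumes "angle_energy \<delta> \<le> 2 * pi * M powr (1 + \<kappa>)" "M \<ge> 0"
  shows "\<bar>\<delta> i\<bar> \<le> amplification * M"
proof -
  have "a i * \<bar>\<delta> i\<bar> powr (1 + \<kappa>) \<le> angle_energy \<delta>"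
    unfolding angle_energy_def
    by (rule member_le_sum[of i UNIV]) (use a_pos in \<open>auto simp: less_imp_le\<close>)
  with assms(1) have "a i * \<bar>\<delta> i\<bar> powr (1 + \<kappa>) \<le> 2 * pi * M powr (1 + \<kappa>)" by linarith
  then have "\<bar>\<delta> i\<bar> powr (1 + \<kappa>) \<le> (2 * pi / a i) * M powr (1 + \<kappa>)"
    using a_pos[of i] by (simp add: field_simps)
  also have "\<dots> \<le> amplification * M powr (1 + \<kappa>)"
    by (intro mult_right_mono ratio_le_amplification) simp
  also have "\<dots> \<le> amplification powr (1 + \<kappa>) * M powr (1 + \<kappa>)"
    using powr_mono[of 1 "1 + \<kappa>" amplification] amplification_ge_1 \<kappa>
    by (intro mult_right_mono) auto
  also have "\<dots> = (amplification * M) powr (1 + \<kappa>)"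
    using amplification_ge_1 \<open>M \<ge> 0\<close> by (simp add: powr_mult)
  finally have "\<bar>\<delta> i\<bar> powr (1 + \<kappa>) \<le> (amplification * M) powr (1 + \<kappa>)" .
  moreover have "0 \<le> amplification * M" using amplification_ge_1 \<open>M \<ge> 0\<close> by simp
  ultimately show ?thesis
    using powr_less_mono2[of "1 + \<kappa>" "amplification * M" "\<bar>\<delta> i\<bar>"] \<kappa> by linarith
qed

definition dissipation :: "('n \<Rightarrow> real) \<Rightarrow> real" where
  "dissipation \<delta> = (\<Sum>i\<in>UNIV. (sgn_powr \<kappa> (\<delta> (succ i)) - sgn_powr \<kappa> (\<delta> i))\<^sup>2)"

text \<open>
  A cyclic sum does not see the difference of the squares of \<open>g (succ i)\<close> and \<open>g i\<close>; what is
  left of the mixed product is the sum of the squared differences.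
\<close>

lemma cyclic_summation_by_parts:
  "(\<Sum>i\<in>UNIV. g i * (g (succ i) - g i)) = - (\<Sum>i\<in>UNIV. (g (succ i) - g i)\<^sup>2) / 2" for g :: "'n \<Rightarrow> real"
proof -
  have "(\<Sum>i\<in>UNIV. (g (succ i) - g i)\<^sup>2 + 2 * (g i * (g (succ i) - g i)))
      = (\<Sum>i\<in>UNIV. (g (succ i))\<^sup>2 - (g i)\<^sup>2)"
    by (intro sum.cong) (auto simp: power2_eq_square algebra_simps)
  also have "\<dots> = 0"
    using sum_cyclic_successor[OF cyclic, of "\<lambda>i. (g i)\<^sup>2"] by (simp add: sum_subtractf)
  finally show ?thesis by (simp add: sum.distrib flip: sum_distrib_left)
qed

text \<open>
  Let \<open>M\<close> be the largest modulus of an error. Because the weighted errors sum to zero, some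
  error has the opposite sign or vanishes, so the signed powers spread over at least
  $M^\kappa$. By \<open>cyclic_variation\<close> and the Cauchy-Schwarz inequality the dissipation is then at
  least $M^{2\kappa}/n$, while the energy is at most $2\pi M^{1+\kappa}$.
\<close>

lemma dissipation_lower_bound:
  assumes balance: "(\<Sum>i\<in>UNIV. a i * \<delta> i) = 0"
  shows "(angle_energy \<delta> / (2 * pi)) powr (2 * \<kappa> / (1 + \<kappa>)) / CARD('n) \<le> dissipation \<delta>"
proof -
  let ?g = "\<lambda>i. sgn_powr \<kappa> (\<delta> i)"
  define M where "M = Max (range (\<lambda>i. \<bar>\<delta> i\<bar>))"
  have le_M: "\<bar>\<delta> i\<bar> \<le> M" for i unfolding M_def by (rule Max_ge) auto
  have "M \<in> range (\<lambda>i. \<bar>\<delta> i\<bar>)" unfolding M_def by (rule Max_in) auto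
  then obtain k where k: "\<bar>\<delta> k\<bar> = M" by auto
  then have "M \<ge> 0" by auto
  obtain j where j: "\<delta> j * \<delta> k \<le> 0"
  proof (rule ccontr)
    assume "\<not> thesis"
    then have "\<delta> j * \<delta> k > 0" for j using that[of j] by linarith
    then have "0 < (\<Sum>j\<in>UNIV. a j * (\<delta> j * \<delta> k))"
      using a_pos by (intro sum_pos) auto
    also have "\<dots> = (\<Sum>j\<in>UNIV. a j * \<delta> j) * \<delta> k" by (simp add: sum_distrib_right mult.assoc)
    finally show False using balance by simp
  qed
  have "?g k * ?g j \<le> 0"
    using j by (auto simp: sgn_powr_def sgn_if mult_le_0_iff split: if_splits)
  then have "\<bar>?g k\<bar> \<le> \<bar>?g k - ?g j\<bar>"
    by (auto simp: mult_le_0_iff)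
  also have "\<dots> \<le> (\<Sum>i\<in>UNIV. \<bar>?g (succ i) - ?g i\<bar>)"
    by (rule cyclic_variation[OF cyclic])
  finally have "M powr \<kappa> \<le> (\<Sum>i\<in>UNIV. \<bar>?g (succ i) - ?g i\<bar>)" by (simp add: abs_sgn_powr k)
  then have "(M powr \<kappa>)\<^sup>2 \<le> (\<Sum>i\<in>UNIV. \<bar>?g (succ i) - ?g i\<bar>)\<^sup>2"
    by (rule power_mono) simp
  also have "\<dots> \<le> CARD('n) * dissipation \<delta>"
    using Cauchy_Schwarz_ineq_sum[of "\<lambda>_. 1" "\<lambda>i. \<bar>?g (succ i) - ?g i\<bar>" UNIV]
    by (simp add: dissipation_def)
  finally have M: "(M powr \<kappa>)\<^sup>2 \<le> CARD('n) * dissipation \<delta>" .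
  have "(angle_energy \<delta> / (2 * pi)) powr (2 * \<kappa> / (1 + \<kappa>)) \<le> (M powr (1 + \<kappa>)) powr (2 * \<kappa> / (1 + \<kappa>))"
    using angle_energy_le[OF le_M] angle_energy_nonneg \<kappa>
    by (intro powr_mono2) (auto simp: field_simps)
  also have "\<dots> = (M powr \<kappa>)\<^sup>2"
    using \<kappa> by (simp add: powr_powr power2_eq_square flip: powr_add)
  finally show ?thesis
    using M by (simp add: pos_divide_le_eq mult.commute)
qed

end

text \<open>
  \<open>z i\<close> and \<open>\<delta> i\<close> are the radius and angle errors. The angular velocity of a follower is its
  tangential speed divided by its radius \<open>R + z i t\<close>, hence the radius errors disturb the angle
  errors, but not conversely. The last two assumptions record that the included angles are
  nonnegative and sum to $2\pi$.
\<close>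

locale error_dynamics = formation_parameters succ a kz kd wd R \<gamma> \<kappa>
  for succ :: "'n::finite \<Rightarrow> 'n" and a :: "'n \<Rightarrow> real"
    and kz kd wd R \<gamma> \<kappa> :: real +
  fixes z \<delta> :: "'n \<Rightarrow> real \<Rightarrow> real"
  assumes radius_pos: "t \<ge> 0 \<Longrightarrow> R + z i t > 0"
    and radius_ode: "t \<ge> 0 \<Longrightarrow>
          (z i has_real_derivative - kz * sgn_powr \<gamma> (z i t)) (at t within {0..})"
    and angle_ode: "t \<ge> 0 \<Longrightarrow>
          (\<delta> i has_real_derivative
             ((kd * sgn_powr \<kappa> (\<delta> (succ i) t) + wd) / (R + z (succ i) t)
              - (kd * sgn_powr \<kappa> (\<delta> i t) + wd) / (R + z i t)) / a i) (at t within {0..})"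
    and angle_balance: "t \<ge> 0 \<Longrightarrow> (\<Sum>i\<in>UNIV. a i * \<delta> i t) = 0"
    and angle_ge: "t \<ge> 0 \<Longrightarrow> \<delta> i t \<ge> - 1"
begin

lemma radius_energy_deriv:
  assumes "t \<ge> 0"
  shows "((\<lambda>t. (z i t)\<^sup>2) has_real_derivative - (2 * kz) * ((z i t)\<^sup>2) powr ((1 + \<gamma>) / 2))
    (at t within {0..})"
proof -
  have "- (2 * kz) * ((z i t)\<^sup>2) powr ((1 + \<gamma>) / 2)
      = 2 * (- kz * sgn_powr \<gamma> (z i t) * z i t)"
    by (simp add: power2_powr_half flip: mult_sgn_powr)
  moreover have "((\<lambda>t. (z i t)\<^sup>2) has_real_derivative 2 * (- kz * sgn_powr \<gamma> (z i t) * z i t))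
      (at t within {0..})"
    using DERIV_power[OF radius_ode[OF assms, of i], of 2] by (simp add: mult.assoc)
  ultimately show ?thesis by metis
qed

lemma abs_radius_error_le:
  assumes "t \<ge> 0"
  shows "\<bar>z i t\<bar> \<le> \<bar>z i 0\<bar>"
proof -
  have "(z i t)\<^sup>2 - (z i 0)\<^sup>2 \<le> 0 * (t - 0)"
    by (rule increment_le_of_derivative_le[OF radius_energy_deriv])
      (use assms gains in \<open>auto intro!: mult_nonneg_nonneg\<close>)
  then show ?thesis by (simp add: abs_le_square_iff)
qed

lemma radius_error_eq_0:
  assumes "\<bar>z i 0\<bar> \<le> r" "t \<ge> settling_time r"
  shows "z i t = 0"
proof -
  have "1 - (1 + \<gamma>) / 2 = (1 - \<gamma>) / 2" by (simp add: field_simps)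
  then have "((z i 0)\<^sup>2) powr (1 - (1 + \<gamma>) / 2) = \<bar>z i 0\<bar> powr (1 - \<gamma>)"
    by (simp only: power2_powr_half)
  moreover have "(2 * kz) * (1 - (1 + \<gamma>) / 2) = kz * (1 - \<gamma>)" by (simp add: field_simps)
  ultimately have "((z i 0)\<^sup>2) powr (1 - (1 + \<gamma>) / 2) / ((2 * kz) * (1 - (1 + \<gamma>) / 2))
      = \<bar>z i 0\<bar> powr (1 - \<gamma>) / (kz * (1 - \<gamma>))"
    by (simp only:)
  also have "\<dots> \<le> settling_time r"
    unfolding settling_time_def using assms(1) \<gamma> gains
    by (intro divide_right_mono powr_mono2) auto
  finally have "(z i t)\<^sup>2 = 0"
    by (intro finite_time_decay[OF radius_energy_deriv, where c = "2 * kz" and \<mu> = "(1 + \<gamma>) / 2"])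
      (use assms gains \<gamma> in auto)
  then show ?thesis by simp
qed

lemma abs_angle_error_le_range:
  assumes "t \<ge> 0"
  shows "\<bar>\<delta> i t\<bar> \<le> angle_error_range"
proof -
  have nonneg: "0 \<le> a j * (1 + \<delta> j t)" for j
    using a_pos[of j] angle_ge[OF assms, of j] by auto
  have "a i * (1 + \<delta> i t) \<le> (\<Sum>j\<in>UNIV. a j * (1 + \<delta> j t))"
    by (rule member_le_sum) (use nonneg in auto)
  also have "\<dots> = 2 * pi"
    using angle_balance[OF assms] by (simp add: distrib_left sum.distrib sum_a)
  finally have "1 + \<delta> i t \<le> 2 * pi / a i"
    using a_pos[of i] by (simp add: field_simps)
  moreover have "0 \<le> 2 * pi / a i" using a_pos[of i] by simp
  ultimately have "\<bar>\<delta> i t\<bar> \<le> 1 + 2 * pi / a i" using angle_ge[OF assms, of i] by linarith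
  also have "\<dots> \<le> angle_error_range"
    unfolding angle_error_range_def
    by (rule member_le_sum) (use a_pos in \<open>auto simp: less_imp_le\<close>)
  finally show ?thesis .
qed

text \<open>
  The factor 2 comes from the radius, which stays above \<open>R / 2\<close> because radius errors never
  grow.
\<close>

lemma abs_angular_speed_le:
  assumes "t \<ge> 0" "\<bar>z i 0\<bar> \<le> R / 2"
  shows "\<bar>(kd * sgn_powr \<kappa> (\<delta> i t) + wd) / (R + z i t)\<bar>
    \<le> 2 * (kd * angle_error_range powr \<kappa> + wd) / R"
proof -
  have "R / 2 \<le> R + z i t"
    using abs_radius_error_le[OF assms(1), of i] assms(2) by linarith
  have "\<bar>kd * sgn_powr \<kappa> (\<delta> i t) + wd\<bar> \<le> kd * \<bar>\<delta> i t\<bar> powr \<kappa> + wd"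
    using abs_triangle_ineq[of "kd * sgn_powr \<kappa> (\<delta> i t)" wd] gains wd_pos
    by (simp add: abs_mult abs_sgn_powr)
  also have "\<dots> \<le> kd * angle_error_range powr \<kappa> + wd"
    using abs_angle_error_le_range[OF assms(1), of i] gains \<kappa>
    by (intro add_right_mono mult_left_mono powr_mono2) auto
  finally have num: "\<bar>kd * sgn_powr \<kappa> (\<delta> i t) + wd\<bar> \<le> kd * angle_error_range powr \<kappa> + wd" .
  have "\<bar>(kd * sgn_powr \<kappa> (\<delta> i t) + wd) / (R + z i t)\<bar>
      = \<bar>kd * sgn_powr \<kappa> (\<delta> i t) + wd\<bar> / (R + z i t)"
    using radius_pos[OF assms(1), of i] by simp
  also have "\<dots> \<le> (kd * angle_error_range powr \<kappa> + wd) / (R / 2)"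
    using num \<open>R / 2 \<le> R + z i t\<close> R_pos by (intro frac_le) auto
  finally show ?thesis by (simp add: algebra_simps)
qed

lemma angle_error_drift:
  assumes "t \<ge> 0" "\<And>i. \<bar>z i 0\<bar> \<le> R / 2"
  shows "\<bar>\<delta> i t\<bar> \<le> \<bar>\<delta> i 0\<bar> + drift_rate * t"
proof -
  define F where "F t = ((kd * sgn_powr \<kappa> (\<delta> (succ i) t) + wd) / (R + z (succ i) t)
              - (kd * sgn_powr \<kappa> (\<delta> i t) + wd) / (R + z i t)) / a i" for t
  define b where "b = 2 * (kd * angle_error_range powr \<kappa> + wd) / R"
  have F: "\<bar>F s\<bar> \<le> drift_rate" if "s \<ge> 0" for s
  proof -
    have "\<bar>F s\<bar> \<le> (b + b) / \<bar>a i\<bar>"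
      unfolding F_def abs_divide[of _ "a i"] b_def
      by (intro divide_right_mono order_trans[OF abs_triangle_ineq4] add_mono
          abs_angular_speed_le that assms(2)) simp
    also have "\<dots> = 4 * (kd * angle_error_range powr \<kappa> + wd) / (R * a i)"
      using a_pos[of i] R_pos by (simp add: b_def field_simps)
    also have "\<dots> \<le> drift_rate"
      unfolding drift_rate_def using a_pos gains wd_pos R_pos
      by (intro member_le_sum[of i UNIV]) (auto simp: less_imp_le)
    finally show ?thesis .
  qed
  have deriv: "(\<delta> i has_real_derivative F s) (at s within {0..})" if "s \<ge> 0" for s
    unfolding F_def by (rule angle_ode[OF that])
  have "\<delta> i t - \<delta> i 0 \<le> drift_rate * (t - 0)"
    by (rule increment_le_of_derivative_le[OF deriv]) (use F assms(1) in \<open>auto simp: abs_le_iff\<close>)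
  moreover have "- \<delta> i t - - \<delta> i 0 \<le> drift_rate * (t - 0)"
    by (rule increment_le_of_derivative_le[OF DERIV_minus[OF deriv]])
      (use F assms(1) in \<open>auto simp: abs_le_iff\<close>)
  ultimately show ?thesis by (simp add: abs_if)
qed

text \<open>
  Once all radii agree, the common drift $w_d$ cancels in the difference of the angular
  velocities.
\<close>

lemma angle_energy_deriv:
  assumes "t \<ge> 0" "\<And>i. z i t = 0"
  shows "((\<lambda>t. angle_energy (\<lambda>i. \<delta> i t)) has_real_derivative
      - ((1 + \<kappa>) * kd / (2 * R)) * dissipation (\<lambda>i. \<delta> i t)) (at t within {0..})"
proof -
  let ?g = "\<lambda>i. sgn_powr \<kappa> (\<delta> i t)"
  have "((\<lambda>t. angle_energy (\<lambda>i. \<delta> i t)) has_real_derivative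
      (\<Sum>i\<in>UNIV. a i * (((1 + \<kappa>) * ?g i) * (((kd * ?g (succ i) + wd) / (R + z (succ i) t)
              - (kd * ?g i + wd) / (R + z i t)) / a i)))) (at t within {0..})"
    unfolding angle_energy_def
    by (intro DERIV_sum DERIV_cmult DERIV_chain2[OF has_real_derivative_abs_powr[OF \<kappa>(1)]]
        angle_ode[OF assms(1)])
  also have "(\<Sum>i\<in>UNIV. a i * (((1 + \<kappa>) * ?g i) * (((kd * ?g (succ i) + wd) / (R + z (succ i) t)
              - (kd * ?g i + wd) / (R + z i t)) / a i)))
      = (\<Sum>i\<in>UNIV. ((1 + \<kappa>) * kd / R) * (?g i * (?g (succ i) - ?g i)))"
    using a_pos R_pos by (intro sum.cong) (auto simp: assms(2) field_simps less_imp_neq[symmetric])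
  also have "\<dots> = - ((1 + \<kappa>) * kd / (2 * R)) * dissipation (\<lambda>i. \<delta> i t)"
    unfolding sum_distrib_left[symmetric] cyclic_summation_by_parts[of ?g] dissipation_def by simp
  finally show ?thesis .
qed

lemma angle_energy_decreasing:
  assumes "0 \<le> T" "\<And>i t. t \<ge> T \<Longrightarrow> z i t = 0" "t \<ge> T"
  shows "angle_energy (\<lambda>i. \<delta> i t) \<le> angle_energy (\<lambda>i. \<delta> i T)"
proof -
  have deriv: "((\<lambda>t. angle_energy (\<lambda>i. \<delta> i t)) has_real_derivative
      - ((1 + \<kappa>) * kd / (2 * R)) * dissipation (\<lambda>i. \<delta> i t)) (at t within {T..})"
    if "t \<ge> T" for t
    by (rule DERIV_subset[OF angle_energy_deriv]) (use assms that in auto)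
  have "angle_energy (\<lambda>i. \<delta> i t) - angle_energy (\<lambda>i. \<delta> i T) \<le> 0 * (t - T)"
    by (rule increment_le_of_derivative_le[OF deriv])
      (use assms gains \<kappa> R_pos in \<open>auto simp: dissipation_def
        intro!: divide_nonneg_pos mult_nonneg_nonneg sum_nonneg\<close>)
  then show ?thesis by simp
qed

lemma angle_errors_vanish:
  assumes T: "0 \<le> T" "\<And>i t. t \<ge> T \<Longrightarrow> z i t = 0"
  shows "\<exists>T'\<ge>T. \<forall>t\<ge>T'. \<forall>i. \<delta> i t = 0"
proof -
  define c where "c = ((1 + \<kappa>) * kd / (2 * R)) * ((1 / (2 * pi)) powr (2 * \<kappa> / (1 + \<kappa>)) / CARD('n))"
  define \<mu> where "\<mu> = 2 * \<kappa> / (1 + \<kappa>)"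
  let ?V = "\<lambda>t. angle_energy (\<lambda>i. \<delta> i t)"
  let ?T' = "T + ?V T powr (1 - \<mu>) / (c * (1 - \<mu>))"
  have "c > 0" using gains \<kappa> R_pos by (simp add: c_def)
  have "\<mu> < 1" using \<kappa> by (simp add: \<mu>_def)
  have deriv: "(?V has_real_derivative
      - ((1 + \<kappa>) * kd / (2 * R)) * dissipation (\<lambda>i. \<delta> i t)) (at t within {T..})"
    if "t \<ge> T" for t
    by (rule DERIV_subset[OF angle_energy_deriv]) (use assms that in auto)
  have decay: "- ((1 + \<kappa>) * kd / (2 * R)) * dissipation (\<lambda>i. \<delta> i t) \<le> - c * ?V t powr \<mu>"
    if "t \<ge> T" for t
  proof -
    have "c * ?V t powr \<mu> = ((1 + \<kappa>) * kd / (2 * R)) * ((?V t / (2 * pi)) powr \<mu> / CARD('n))"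
      using angle_energy_nonneg by (simp add: c_def \<mu>_def powr_divide)
    also have "\<dots> \<le> ((1 + \<kappa>) * kd / (2 * R)) * dissipation (\<lambda>i. \<delta> i t)"
      unfolding \<mu>_def using gains \<kappa> R_pos T(1) that
      by (intro mult_left_mono dissipation_lower_bound angle_balance) auto
    finally show ?thesis by linarith
  qed
  have "\<delta> i t = 0" if "t \<ge> ?T'" for t i
  proof -
    have "?V t = 0"
      by (rule finite_time_decay[OF deriv decay angle_energy_nonneg \<open>c > 0\<close> \<open>\<mu> < 1\<close> that])
    then have "a i * \<bar>\<delta> i t\<bar> powr (1 + \<kappa>) = 0"
      unfolding angle_energy_def using a_pos by (subst (asm) sum_nonneg_eq_0_iff) (auto simp: less_imp_le)
    then show ?thesis using a_pos[of i] by simp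
  qed
  moreover have "?T' \<ge> T" using \<open>c > 0\<close> \<open>\<mu> < 1\<close> by simp
  ultimately show ?thesis by blast
qed

lemma errors_vanish:
  "\<exists>T\<ge>0. \<forall>t\<ge>T. \<forall>i. z i t = 0 \<and> \<delta> i t = 0"
proof -
  define r where "r = Max (range (\<lambda>i. \<bar>z i 0\<bar>))"
  have "\<bar>z i 0\<bar> \<le> r" for i unfolding r_def by (rule Max_ge) auto
  then have z: "z i t = 0" if "t \<ge> settling_time r" for i t
    using radius_error_eq_0 that by blast
  then obtain T' where "T' \<ge> settling_time r" "\<And>t i. t \<ge> T' \<Longrightarrow> \<delta> i t = 0"
    using angle_errors_vanish[OF settling_time_nonneg] by metis
  then show ?thesis
    using z settling_time_nonneg[of r] by (intro exI[of _ T']) auto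
qed

text \<open>
  Until the radii have settled, the angle errors grow at most at the rate \<^const>\<open>drift_rate\<close>;
  afterwards the energy keeps them within a constant factor of the size they have reached.
\<close>

lemma angle_error_le_bound:
  assumes "r \<le> R / 2" "\<And>i. \<bar>z i 0\<bar> \<le> r" "\<And>i. \<bar>\<delta> i 0\<bar> \<le> r" "t \<ge> 0"
  shows "\<bar>\<delta> i t\<bar> \<le> angle_bound r"
proof -
  define b where "b = r + drift_rate * settling_time r"
  have "r \<ge> 0" using assms(3)[of i] by linarith
  then have "b \<ge> 0"
    unfolding b_def using drift_rate_nonneg settling_time_nonneg[of r] by simp
  have transient: "\<bar>\<delta> i t\<bar> \<le> b" if "0 \<le> t" "t \<le> settling_time r" for i t
  proof -
    have "\<bar>\<delta> i t\<bar> \<le> \<bar>\<delta> i 0\<bar> + drift_rate * t"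
      by (rule angle_error_drift) (use that assms(1,2) order_trans in blast)+
    also have "\<dots> \<le> b"
      unfolding b_def using assms(3) drift_rate_nonneg that by (intro add_mono mult_left_mono) auto
    finally show ?thesis .
  qed
  show ?thesis
  proof (cases "t \<le> settling_time r")
    case True
    have "b \<le> amplification * b"
      using amplification_ge_1 \<open>b \<ge> 0\<close> by (simp add: mult_le_cancel_right1)
    with transient[OF assms(4) True, of i] show ?thesis
      by (simp add: angle_bound_def b_def)
  next
    case False
    have "angle_energy (\<lambda>i. \<delta> i t) \<le> angle_energy (\<lambda>i. \<delta> i (settling_time r))"
      by (rule angle_energy_decreasing)
        (use False settling_time_nonneg radius_error_eq_0[OF assms(2)] in auto)
    also have "\<dots> \<le> 2 * pi * b powr (1 + \<kappa>)"
      by (rule angle_energy_le[OF transient]) (auto simp: settling_time_nonneg)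
    finally show ?thesis
      unfolding angle_bound_def b_def[symmetric] using \<open>b \<ge> 0\<close> by (rule le_of_angle_energy_le)
  qed
qed

end

section \<open>The geometry of the relative positions\<close>

definition planar :: "real ^ 2 \<Rightarrow> complex" where
  "planar x = Complex (x $ 1) (x $ 2)"

lemma norm_planar: "norm (planar x) = norm x"
  by (simp add: planar_def cmod_def norm_vec_def L2_set_def sum_2)

lemma planar_eq_0_iff: "planar x = 0 \<longleftrightarrow> x = 0"
  using norm_planar[of x] by (metis norm_eq_zero)

lemma bounded_linear_planar: "bounded_linear planar"
  unfolding linear_conv_bounded_linear[symmetric]
  by (rule linearI) (simp_all add: planar_def complex_eq_iff)

text \<open>
  In complex notation the control law reads $\dot D = D\,(w + \mathrm{i}u)/\rho$: the radial and
  the angular motion are the real and the imaginary part of the logarithmic derivative.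
\<close>

lemma planar_velocity:
  assumes "x \<noteq> 0"
  shows "planar (w *\<^sub>R radial_dir x + u *\<^sub>R tangential_dir x)
    = planar x * Complex (w / norm x) (u / norm x)"
  using assms
  by (simp add: planar_def radial_dir_def tangential_dir_def complex_eq_iff field_simps)

lemma norm_deriv_polar:
  assumes "(d has_vector_derivative w *\<^sub>R radial_dir (d t) + u *\<^sub>R tangential_dir (d t)) (at t within S)"
    and "d t \<noteq> 0"
  shows "((\<lambda>t. norm (d t)) has_real_derivative w) (at t within S)"
proof -
  have "((\<lambda>t. norm (d t)) has_derivative
      (\<lambda>h. (h *\<^sub>R (w *\<^sub>R radial_dir (d t) + u *\<^sub>R tangential_dir (d t))) \<bullet> sgn (d t))) (at t within S)"
    using has_derivative_compose[OF assms(1)[unfolded has_vector_derivative_def]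
        has_derivative_norm[OF assms(2)]] .
  moreover have "radial_dir (d t) \<bullet> sgn (d t) = 1"
  proof -
    have "radial_dir (d t) = sgn (d t)" by (simp add: radial_dir_def sgn_div_norm divide_inverse)
    then show ?thesis using assms(2) by (simp add: norm_sgn flip: power2_norm_eq_inner)
  qed
  moreover have "tangential_dir (d t) \<bullet> sgn (d t) = 0"
    by (simp add: tangential_dir_def sgn_div_norm inner_vec_def sum_2)
  ultimately show ?thesis
    unfolding has_field_derivative_def
    by (simp add: inner_add_left mult_commute_abs)
qed

text \<open>
  Both sides lie in $[0, 2\pi)$ and are congruent modulo $2\pi$. The right-hand side no longer
  refers to the individual polar angles, which jump when a follower crosses the negative real
  axis.
\<close>

lemma included_angle_eq_Arg2pi:
  assumes "d i \<noteq> 0" "d (succ i) \<noteq> 0"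
  shows "included_angle succ d i = Arg2pi (planar (d (succ i)) / planar (d i))"
proof -
  let ?\<theta> = "\<lambda>k. Arg (planar (d k))"
  have nz: "planar (d i) \<noteq> 0" "planar (d (succ i)) \<noteq> 0"
    using assms by (simp_all add: planar_eq_0_iff)
  have ex: "\<exists>n::int. included_angle succ d i = ?\<theta> (succ i) - ?\<theta> i + 2 * pi * n"
    unfolding included_angle_def polar_angle_def planar_def[symmetric] Let_def
    by (rule exI[of _ "if ?\<theta> (succ i) - ?\<theta> i \<ge> 0 then 0 else 1"]) simp
  then obtain n :: int where n: "included_angle succ d i = ?\<theta> (succ i) - ?\<theta> i + 2 * pi * n" by blast
  have "cis (included_angle succ d i) = cis (?\<theta> (succ i)) / cis (?\<theta> i)"
    unfolding n by (simp add: cis_divide flip: cis_mult)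
  also have "\<dots> = sgn (planar (d (succ i)) / planar (d i))"
    using nz by (simp add: cis_Arg sgn_divide)
  finally have cis: "cis (included_angle succ d i) = sgn (planar (d (succ i)) / planar (d i))" .
  have "0 \<le> included_angle succ d i" "included_angle succ d i < 2 * pi"
    using Arg_bounded[of "planar (d i)"] Arg_bounded[of "planar (d (succ i))"]
    by (auto simp: included_angle_def polar_angle_def planar_def[symmetric] Let_def)
  then show ?thesis
    using nz
    by (intro Arg2pi_unique[symmetric, of "norm (planar (d (succ i)) / planar (d i))"])
      (auto simp flip: cis_conv_exp simp: cis sgn_eq)
qed

text \<open>
  \<^const>\<open>Arg2pi\<close> is discontinuous on the positive real axis, where the angle may jump between
  0 and $2\pi$. If angle \<open>i\<close> vanishes at time \<open>t\<close>, some other angle \<open>j\<close> equals \<open>b > 0\<close> there,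
  since the sum is $2\pi$, and angle \<open>j\<close> is continuous at \<open>t\<close>. Thus near \<open>t\<close> angle \<open>i\<close> is at
  most $2\pi - b/2$; being small modulo $2\pi$, it must be small.
\<close>

lemma continuous_Arg2pi_of_sum_2pi:
  fixes q :: "'n::finite \<Rightarrow> real \<Rightarrow> complex"
  assumes cont: "\<And>i. continuous (at t within S) (q i)"
    and nz: "\<And>i s. s \<in> S \<Longrightarrow> q i s \<noteq> 0"
    and sum: "\<And>s. s \<in> S \<Longrightarrow> (\<Sum>i\<in>UNIV. Arg2pi (q i s)) = 2 * pi"
    and "t \<in> S"
  shows "continuous (at t within S) (\<lambda>s. Arg2pi (q i s))"
proof -
  have regular: "continuous (at t within S) (\<lambda>s. Arg2pi (q j s))" if "Arg2pi (q j t) \<noteq> 0" for j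
  proof -
    have "q j t \<notin> \<real>\<^sub>\<ge>\<^sub>0"
      using that by (auto simp: Arg2pi_eq_0 complex_nonneg_Reals_iff complex_is_Real_iff)
    then show ?thesis
      using continuous_within_compose3[OF continuous_at_Arg2pi cont] by simp
  qed
  show ?thesis
  proof (cases "Arg2pi (q i t) = 0")
    case False
    then show ?thesis by (rule regular)
  next
    case True
    obtain j where j: "Arg2pi (q j t) \<noteq> 0"
      using sum[OF \<open>t \<in> S\<close>] by (cases "\<forall>j. Arg2pi (q j t) = 0") auto
    define b where "b = Arg2pi (q j t)"
    have "b > 0" using j Arg2pi[of "q j t"] by (auto simp: b_def)
    have "i \<noteq> j" using True j by auto
    have ev: "eventually (\<lambda>s. s \<in> S) (at t within S)"
      by (simp add: eventually_at_filter)
    have "((\<lambda>s. Arg2pi (q j s)) \<longlongrightarrow> b) (at t within S)"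
      using regular[OF j] by (simp add: continuous_within b_def)
    then have ev_j: "eventually (\<lambda>s. Arg2pi (q j s) > b / 2) (at t within S)"
      by (rule order_tendstoD) (use \<open>b > 0\<close> in simp)
    have bound: "eventually (\<lambda>s. Arg2pi (q i s) \<le> 2 * pi - b / 2) (at t within S)"
      using ev ev_j
    proof eventually_elim
      case (elim s)
      have "(\<Sum>k\<in>{i, j}. Arg2pi (q k s)) \<le> (\<Sum>k\<in>UNIV. Arg2pi (q k s))"
        by (rule sum_mono2) (auto simp: Arg2pi)
      then show ?case using sum[OF elim(1)] elim(2) \<open>i \<noteq> j\<close> by simp
    qed
    have cos_eq: "cos (Arg2pi (q i s)) = Re (q i s) / norm (q i s)" if "s \<in> S" for s
      using cos_Arg2pi[of "q i s"] nz[OF that, of i] by (simp add: field_simps)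
    have "((\<lambda>s. Re (q i s) / norm (q i s)) \<longlongrightarrow> Re (q i t) / norm (q i t)) (at t within S)"
      using cont[of i] nz[OF \<open>t \<in> S\<close>, of i] by (auto intro!: tendsto_intros simp: continuous_within)
    moreover have "Re (q i t) / norm (q i t) = 1"
      using cos_eq[OF \<open>t \<in> S\<close>] True by (simp only: cos_zero)
    ultimately have cos_lim: "((\<lambda>s. Re (q i s) / norm (q i s)) \<longlongrightarrow> 1) (at t within S)"
      by (simp only:)
    have "((\<lambda>s. Arg2pi (q i s)) \<longlongrightarrow> 0) (at t within S)"
    proof (rule tendstoI)
      fix e :: real assume "e > 0"
      define e' where "e' = min (min e (b / 2)) pi"
      have e': "0 < e'" "e' \<le> e" "e' \<le> b / 2" "e' \<le> pi"
        using \<open>e > 0\<close> \<open>b > 0\<close> by (auto simp: e'_def)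
      have "cos e' < 1" using e' cos_monotone_0_pi[of 0 e'] by simp
      then have "eventually (\<lambda>s. Re (q i s) / norm (q i s) > cos e') (at t within S)"
        by (rule order_tendstoD[OF cos_lim])
      then show "eventually (\<lambda>s. dist (Arg2pi (q i s)) 0 < e) (at t within S)"
        using ev bound
      proof eventually_elim
        case (elim s)
        let ?B = "Arg2pi (q i s)"
        have "?B < e'"
        proof (rule ccontr)
          assume "\<not> ?B < e'"
          have "cos ?B \<le> cos e'"
          proof (cases "?B \<le> pi")
            case True
            then show ?thesis using cos_monotone_0_pi_le[of e' ?B] \<open>\<not> ?B < e'\<close> e' by simp
          next
            case False
            have "cos ?B = cos (2 * pi - ?B)" by simp
            also have "\<dots> \<le> cos e'"
              by (rule cos_monotone_0_pi_le) (use False elim(3) e' in auto)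
            finally show ?thesis .
          qed
          then show False using elim(1) cos_eq[OF elim(2)] by simp
        qed
        then show ?case using Arg2pi[of "q i s"] e' by simp
      qed
    qed
    then show ?thesis using True by (simp add: continuous_within)
  qed
qed

text \<open>
  Where \<^const>\<open>Arg2pi\<close> varies continuously along the curve, its increment from \<open>t\<close> is the
  imaginary part of the principal logarithm of \<open>q s / q t\<close>, and this is differentiable because
  the quotient starts at 1, away from the branch cut.
\<close>

lemma has_real_derivative_Arg2pi_of_continuous:
  fixes q :: "real \<Rightarrow> complex"
  assumes deriv: "(q has_vector_derivative q t * w) (at t within S)"
    and "q t \<noteq> 0" "t \<in> S"
    and cont: "continuous (at t within S) (\<lambda>s. Arg2pi (q s))"
  shows "((\<lambda>s. Arg2pi (q s)) has_real_derivative Im w) (at t within S)"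
proof -
  let ?B = "\<lambda>s. Arg2pi (q s)"
  have "((\<lambda>s. q s / q t) has_vector_derivative w) (at t within S)"
    using has_vector_derivative_divide[OF deriv, of "q t"] \<open>q t \<noteq> 0\<close> by simp
  moreover have "(Ln has_field_derivative inverse 1) (at ((\<lambda>s. q s / q t) t) within (\<lambda>s. q s / q t) ` S)"
    using DERIV_subset[OF has_field_derivative_Ln[of 1]] \<open>q t \<noteq> 0\<close> by simp
  ultimately have "((Ln \<circ> (\<lambda>s. q s / q t)) has_vector_derivative w * inverse 1) (at t within S)"
    by (rule field_vector_diff_chain_within)
  then have "((\<lambda>s. ?B t + Im (Ln (q s / q t))) has_vector_derivative 0 + Im w) (at t within S)"
    by (intro has_vector_derivative_add has_vector_derivative_const
        bounded_linear.has_vector_derivative[OF bounded_linear_Im]) (simp add: o_def)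
  then have Ln_deriv: "((\<lambda>s. ?B t + Im (Ln (q s / q t))) has_real_derivative Im w) (at t within S)"
    by (simp add: has_real_derivative_iff_has_vector_derivative)
  have "continuous (at t within S) q"
    using deriv by (rule has_vector_derivative_continuous)
  then have "eventually (\<lambda>s. dist (q s) (q t) < norm (q t)) (at t within S)"
    using \<open>q t \<noteq> 0\<close> by (auto simp: continuous_within tendsto_iff)
  moreover have "eventually (\<lambda>s. dist (?B s) (?B t) < pi) (at t within S)"
    using cont by (auto simp: continuous_within tendsto_iff)
  ultimately have "eventually (\<lambda>s. ?B t + Im (Ln (q s / q t)) = ?B s) (at t within S)"
  proof eventually_elim
    case (elim s)
    then have "q s \<noteq> 0" by auto
    define r where "r = norm (q s) / norm (q t)"
    have "r > 0" using \<open>q s \<noteq> 0\<close> \<open>q t \<noteq> 0\<close> by (simp add: r_def)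
    have polar: "q x = norm (q x) * cis (?B x)" for x
      using Arg2pi_eq[of "q x"] by (simp add: cis_conv_exp)
    have "q s / q t = (norm (q s) * cis (?B s)) / (norm (q t) * cis (?B t))"
      using polar[of s] polar[of t] by presburger
    also have "\<dots> = r * cis (?B s - ?B t)"
      by (simp add: r_def flip: cis_divide)
    also have "\<dots> = exp (Complex (ln r) (?B s - ?B t))"
      using \<open>r > 0\<close> by (simp add: exp_eq_polar exp_of_real[symmetric])
    finally have "Ln (q s / q t) = Complex (ln r) (?B s - ?B t)"
      using elim(2) by (intro Ln_unique) (auto simp: dist_real_def)
    then show ?case by simp
  qed
  then obtain e where "e > 0" "\<And>s. s \<in> S \<Longrightarrow> s \<noteq> t \<Longrightarrow> dist s t < e \<Longrightarrow> ?B t + Im (Ln (q s / q t)) = ?B s"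
    unfolding eventually_at by blast
  moreover have "?B t + Im (Ln (q t / q t)) = ?B t" using \<open>q t \<noteq> 0\<close> by simp
  ultimately have "?B t + Im (Ln (q s / q t)) = ?B s" if "s \<in> S" "dist s t < e" for s
    using that by (cases "s = t") auto
  then show ?thesis
    by (rule has_field_derivative_transform_within[OF Ln_deriv \<open>e > 0\<close> \<open>t \<in> S\<close>])
qed

lemma has_real_derivative_included_angle:
  fixes d :: "'n::finite \<Rightarrow> real \<Rightarrow> real ^ 2" and w u :: "'n \<Rightarrow> real"
  assumes nz: "\<And>i s. s \<in> S \<Longrightarrow> d i s \<noteq> 0"
    and arranged: "\<And>s. s \<in> S \<Longrightarrow> ccw_arranged succ (\<lambda>i. d i s)"
    and deriv: "\<And>i. (d i has_vector_derivative
          w i *\<^sub>R radial_dir (d i t) + u i *\<^sub>R tangential_dir (d i t)) (at t within S)"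
    and "t \<in> S"
  shows "((\<lambda>s. included_angle succ (\<lambda>i. d i s) i) has_real_derivative
      u (succ i) / norm (d (succ i) t) - u i / norm (d i t)) (at t within S)"
proof -
  define D where "D i s = planar (d i s)" for i s
  define q where "q i s = D (succ i) s / D i s" for i s
  define w' where "w' i = Complex (w i / norm (d i t)) (u i / norm (d i t))" for i
  have D_nz: "D i s \<noteq> 0" if "s \<in> S" for i s
    using nz[OF that] by (simp add: D_def planar_eq_0_iff)
  have D_deriv: "(D i has_vector_derivative D i t * w' i) (at t within S)" for i
    using bounded_linear.has_vector_derivative[OF bounded_linear_planar deriv[of i]]
      planar_velocity[OF nz[OF \<open>t \<in> S\<close>], of "w i" i "u i"]
    by (simp add: D_def[abs_def] w'_def)
  have q_deriv: "(q i has_vector_derivative q i t * (w' (succ i) - w' i)) (at t within S)" for i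
  proof -
    have inv: "((\<lambda>s. inverse (D i s)) has_vector_derivative
        (D i t * w' i) * (- (inverse (D i t) ^ Suc (Suc 0)))) (at t within S)"
      using field_vector_diff_chain_within[OF D_deriv DERIV_inverse[OF D_nz[OF \<open>t \<in> S\<close>]]]
      by (simp add: o_def)
    show ?thesis
      using has_vector_derivative_mult[OF D_deriv[of "succ i"] inv] D_nz[OF \<open>t \<in> S\<close>, of i]
      by (simp add: q_def[abs_def] divide_inverse algebra_simps power2_eq_square)
  qed
  have eq: "included_angle succ (\<lambda>i. d i s) k = Arg2pi (q k s)" if "s \<in> S" for k s
    using included_angle_eq_Arg2pi[of "\<lambda>i. d i s" k succ] nz[OF that] by (simp add: q_def D_def)
  have "continuous (at t within S) (\<lambda>s. Arg2pi (q i s))"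
  proof (rule continuous_Arg2pi_of_sum_2pi)
    show "continuous (at t within S) (q i)" for i
      using q_deriv by (rule has_vector_derivative_continuous)
    show "q i s \<noteq> 0" if "s \<in> S" for i s using D_nz[OF that] by (simp add: q_def)
    show "(\<Sum>i\<in>UNIV. Arg2pi (q i s)) = 2 * pi" if "s \<in> S" for s
      using sum_included_angle[OF arranged[OF that]] eq[OF that] by simp
  qed fact
  then have "((\<lambda>s. Arg2pi (q i s)) has_real_derivative Im (w' (succ i) - w' i)) (at t within S)"
    using D_nz[OF \<open>t \<in> S\<close>] by (intro has_real_derivative_Arg2pi_of_continuous q_deriv \<open>t \<in> S\<close>)
      (auto simp: q_def)
  then have "((\<lambda>s. included_angle succ (\<lambda>i. d i s) i) has_real_derivative Im (w' (succ i) - w' i))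
      (at t within S)"
    by (rule has_field_derivative_transform_within[OF _ zero_less_one \<open>t \<in> S\<close>]) (simp add: eq)
  then show ?thesis by (simp add: w'_def)
qed

section \<open>Finite-time stability of the error dynamics\<close>

context formation_parameters
begin

lemma finite_time_stable_errors:
  fixes S :: "(real \<Rightarrow> (real ^ 'n) \<times> (real ^ 'n)) set"
  assumes traj: "\<And>x. x \<in> S \<Longrightarrow> \<exists>z \<delta>. error_dynamics succ a kz kd wd R \<gamma> \<kappa> z \<delta> \<and>
      (\<forall>t. x t = ((\<chi> i. z i t), (\<chi> i. \<delta> i t)))"
  shows "finite_time_stable_origin S"
  unfolding finite_time_stable_origin_def
proof (intro conjI allI impI ballI)
  fix \<epsilon> :: real assume "\<epsilon> > 0"
  define N where "N = real CARD('n)"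
  have "N > 0" by (simp add: N_def)
  \<comment> \<open>The norm of a pair of vectors is at most the sum of the moduli of its \<open>2 * n\<close> entries.\<close>
  define e where "e = \<epsilon> / (2 * N)"
  have "e > 0" using \<open>\<epsilon> > 0\<close> \<open>N > 0\<close> by (simp add: e_def)
  have "eventually (\<lambda>r. angle_bound r < e \<and> r < min (R / 2) e \<and> 0 < r) (at_right 0)"
    using \<open>e > 0\<close> R_pos
    by (intro eventually_conj order_tendstoD(2)[OF angle_bound_tendsto_0]
        eventually_at_right_less eventually_at_rightI[of 0 "min (R / 2) e"]) auto
  then obtain r where r: "angle_bound r < e" "r < R / 2" "r < e" "0 < r"
    using eventually_happens trivial_limit_at_right_real by fastforce
  show "\<exists>\<eta>>0. \<forall>x\<in>S. norm (x 0) < \<eta> \<longrightarrow> (\<forall>t\<ge>0. norm (x t) < \<epsilon>)"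
  proof (intro exI[of _ r] conjI ballI impI allI \<open>0 < r\<close>)
    fix x t assume "x \<in> S" and small: "norm (x 0) < r" and "(0 :: real) \<le> t"
    obtain z \<delta> where "error_dynamics succ a kz kd wd R \<gamma> \<kappa> z \<delta>"
      and x: "\<And>t. x t = ((\<chi> i. z i t), (\<chi> i. \<delta> i t))"
      using traj[OF \<open>x \<in> S\<close>] by blast
    then interpret error_dynamics succ a kz kd wd R \<gamma> \<kappa> z \<delta> by simp
    have z0: "\<bar>z i 0\<bar> \<le> r" for i
      using component_le_norm_cart[of "fst (x 0)" i] norm_fst_le[of "fst (x 0)" "snd (x 0)"] small
      by (simp add: x)
    have \<delta>0: "\<bar>\<delta> i 0\<bar> \<le> r" for i
      using component_le_norm_cart[of "snd (x 0)" i] norm_snd_le[of "snd (x 0)" "fst (x 0)"] small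
      by (simp add: x)
    have "norm (fst (x t)) \<le> (\<Sum>i\<in>UNIV. \<bar>z i t\<bar>)"
      using norm_le_l1_cart[of "fst (x t)"] by (simp add: x)
    also have "\<dots> < (\<Sum>i\<in>(UNIV :: 'n set). e)"
      using abs_radius_error_le[OF \<open>0 \<le> t\<close>] z0 r(3)
      by (intro sum_strict_mono) (auto intro: order.strict_trans1 order_trans)
    finally have 1: "norm (fst (x t)) < \<epsilon> / 2" using \<open>N > 0\<close> by (simp add: e_def N_def)
    have "norm (snd (x t)) \<le> (\<Sum>i\<in>UNIV. \<bar>\<delta> i t\<bar>)"
      using norm_le_l1_cart[of "snd (x t)"] by (simp add: x)
    also have "\<dots> < (\<Sum>i\<in>(UNIV :: 'n set). e)"
      using angle_error_le_bound[OF _ z0 \<delta>0 \<open>0 \<le> t\<close>] r(1,2)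
      by (intro sum_strict_mono) (auto intro: order.strict_trans1 less_imp_le)
    finally have 2: "norm (snd (x t)) < \<epsilon> / 2" using \<open>N > 0\<close> by (simp add: e_def N_def)
    show "norm (x t) < \<epsilon>"
      using norm_Pair_le[of "fst (x t)" "snd (x t)"] 1 2 by simp
  qed
next
  fix x assume "x \<in> S"
  then obtain z \<delta> where "error_dynamics succ a kz kd wd R \<gamma> \<kappa> z \<delta>"
    and x: "\<And>t. x t = ((\<chi> i. z i t), (\<chi> i. \<delta> i t))"
    using traj[OF \<open>x \<in> S\<close>] by blast
  then interpret error_dynamics succ a kz kd wd R \<gamma> \<kappa> z \<delta> by simp
  obtain T where "T \<ge> 0" "\<And>t i. t \<ge> T \<Longrightarrow> z i t = 0 \<and> \<delta> i t = 0"
    using errors_vanish by blast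
  then show "\<exists>T\<ge>0. \<forall>t>T. x t = 0"
    by (intro exI[of _ T]) (auto simp: x vec_eq_iff zero_prod_def)
qed

end

section \<open>From the closed loop to the error dynamics\<close>

text \<open>
  The controller feeds the derivative of the estimate forward as \<^const>\<open>vector_derivative\<close>,
  which is an arbitrary value unless the estimate is differentiable.
\<close>

lemma estimate_differentiable:
  fixes NT :: "'n::finite \<Rightarrow> 'm::finite set"
  assumes "\<And>j. (pt j has_vector_derivative v j) (at t within S)"
    and "(Phi i has_vector_derivative w) (at t within S)"
  shows "estimate NT pt Phi i differentiable at t within S"
proof -
  have "((\<lambda>t. Phi i t + (real CARD('n) / real CARD('m)) *\<^sub>R
        (\<Sum>j\<in>NT i. (1 / real (card (observers NT j))) *\<^sub>R pt j t)) has_vector_derivative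
      w + (real CARD('n) / real CARD('m)) *\<^sub>R
        (\<Sum>j\<in>NT i. (1 / real (card (observers NT j))) *\<^sub>R v j)) (at t within S)"
    by (intro has_vector_derivative_add has_vector_derivative_sum assms
        bounded_linear.has_vector_derivative[OF bounded_linear_scaleR_right])
  then show ?thesis
    unfolding estimate_def[abs_def] observed_input_def by (rule differentiableI_vector)
qed

text \<open>
  The feedforward term $\dot r_i$ cancels, so the position of a follower relative to its
  estimate moves with the radial speed $w_{z,i}$ and the tangential speed $w_{\delta,i}$ alone.
\<close>

lemma closed_loop_error_dynamics:
  fixes A :: "'n::finite \<Rightarrow> 'n \<Rightarrow> real" and NT :: "'n \<Rightarrow> 'm::finite set"
    and pt v :: "'m \<Rightarrow> real \<Rightarrow> real ^ 2"
  assumes leaders: "\<And>j t. t \<ge> 0 \<Longrightarrow> (pt j has_vector_derivative v j t) (at t within {0..})"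
    and pattern: "admissible_pattern pt wd rhod a"
    and gains: "kz > 0" "kd > 0"
    and alpha2: "odd p2" "odd q2" "0 < q2" "q2 < p2"
    and alpha3: "odd p3" "odd q3" "0 < q3" "q3 < p3"
    and loop: "closed_loop A NT pt ke kz kd p1 q1 p2 q2 p3 q3 wd rhod a succ Phi p"
  defines "d \<equiv> \<lambda>t i. p i t - estimate NT pt Phi i t"
  shows "error_dynamics succ a kz kd wd rhod (real q2 / real p2) (real q3 / real p3)
    (\<lambda>i t. radius_error rhod (d t) i) (\<lambda>i t. angle_error a succ (d t) i)"
proof -
  let ?z = "\<lambda>i t. radius_error rhod (d t) i" and ?\<delta> = "\<lambda>i t. angle_error a succ (d t) i"
  have a_pos: "\<And>i. a i > 0" and sum_a: "(\<Sum>i\<in>UNIV. a i) = 2 * pi" and "wd > 0"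
    and rhod: "rhod > Max (range (\<lambda>j. norm (pt j 0 - leader_average pt 0)))"
    using pattern by (auto simp: admissible_pattern_def)
  have "norm (pt undefined 0 - leader_average pt 0)
      \<le> Max (range (\<lambda>j. norm (pt j 0 - leader_average pt 0)))"
    by (rule Max_ge) auto
  then have "rhod > 0" using rhod norm_ge_zero order_trans le_less_trans by blast
  have nz: "d t i \<noteq> 0" and arranged: "ccw_arranged succ (d t)" if "t \<ge> 0" for t i
    using loop that by (auto simp: closed_loop_def Let_def d_def)
  define wz where "wz t i = - kz * odd_pow q2 p2 (?z i t)" for t i
  define w\<delta> where "w\<delta> t i = kd * odd_pow q3 p3 (?\<delta> i t) + wd" for t i
  have d_deriv: "((\<lambda>t. d t i) has_vector_derivative
      wz t i *\<^sub>R radial_dir (d t i) + w\<delta> t i *\<^sub>R tangential_dir (d t i)) (at t within {0..})"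
    if "t \<ge> 0" for t i
  proof -
    let ?r = "estimate NT pt Phi i"
    have p: "(p i has_vector_derivative wz t i *\<^sub>R radial_dir (d t i)
        + w\<delta> t i *\<^sub>R tangential_dir (d t i) + vector_derivative ?r (at t within {0..})) (at t within {0..})"
      using loop that by (auto simp: closed_loop_def Let_def d_def wz_def w\<delta>_def)
    have "(Phi i has_vector_derivative ke *\<^sub>R (\<Sum>j\<in>nbrs A i. A i j *\<^sub>R
        odd_pow_vec q1 p1 (estimate NT pt Phi j t - estimate NT pt Phi i t))) (at t within {0..})"
      using loop that by (auto simp: closed_loop_def Let_def)
    then have "?r differentiable at t within {0..}"
      by (rule estimate_differentiable[OF leaders[OF that]])
    moreover have "at t within {0..} \<noteq> bot"
    proof -
      have "at_right t \<le> at t within {0..}" using that by (intro at_le) auto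
      then show ?thesis using trivial_limit_at_right_real[of t] by (auto simp: bot_unique)
    qed
    ultimately have "(?r has_vector_derivative vector_derivative ?r (at t within {0..})) (at t within {0..})"
      by (simp add: vector_derivative_works)
    from has_vector_derivative_diff[OF p this] show ?thesis by (simp add: d_def)
  qed
  have cyclic: "cyclic_successor succ"
    using arranged[of 0] unfolding ccw_arranged_def cyclic_successor_def by auto
  show ?thesis
  proof unfold_locales
    show "cyclic_successor succ" "0 < a i" "sum a UNIV = 2 * pi" "0 < kz" "0 < kd" "0 < wd" "0 < rhod" for i
      by fact+
    show "0 < real q2 / real p2" "real q2 / real p2 < 1" "0 < real q3 / real p3" "real q3 / real p3 < 1"
      using alpha2 alpha3 by auto
    fix t :: real and i assume t: "0 \<le> t"
    show "0 < rhod + ?z i t"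
      using nz[OF t, of i] by (simp add: radius_error_def)
    have "((\<lambda>t. norm (d t i) - rhod) has_real_derivative wz t i - 0) (at t within {0..})"
      using norm_deriv_polar[OF d_deriv[OF t] nz[OF t]] by (intro DERIV_diff DERIV_const)
    then show "(?z i has_real_derivative - kz * sgn_powr (real q2 / real p2) (?z i t)) (at t within {0..})"
      by (simp add: radius_error_def wz_def odd_pow_eq_sgn_powr alpha2)
    have "((\<lambda>s. included_angle succ (\<lambda>i. d s i) i) has_real_derivative
        w\<delta> t (succ i) / norm (d t (succ i)) - w\<delta> t i / norm (d t i)) (at t within {0..})"
      by (rule has_real_derivative_included_angle) (use nz arranged d_deriv t in auto)
    then have "((\<lambda>s. included_angle succ (d s) i / a i - 1) has_real_derivative
        (w\<delta> t (succ i) / norm (d t (succ i)) - w\<delta> t i / norm (d t i)) / a i - 0) (at t within {0..})"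
      by (intro DERIV_diff DERIV_const DERIV_cdivide)
    then show "(?\<delta> i has_real_derivative
        ((kd * sgn_powr (real q3 / real p3) (?\<delta> (succ i) t) + wd) / (rhod + ?z (succ i) t)
         - (kd * sgn_powr (real q3 / real p3) (?\<delta> i t) + wd) / (rhod + ?z i t)) / a i) (at t within {0..})"
      by (simp add: angle_error_def radius_error_def w\<delta>_def odd_pow_eq_sgn_powr alpha3)
    have "(\<Sum>i\<in>UNIV. a i * ?\<delta> i t) = (\<Sum>i\<in>UNIV. included_angle succ (d t) i - a i)"
      using a_pos by (intro sum.cong) (auto simp: angle_error_def field_simps less_imp_neq[symmetric])
    then show "(\<Sum>i\<in>UNIV. a i * ?\<delta> i t) = 0"
      using sum_included_angle[OF arranged[OF t]] sum_a by (simp add: sum_subtractf)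
    have "included_angle succ (d t) i \<ge> 0"
      using included_angle_eq_Arg2pi[of "d t" i succ] nz[OF t] Arg2pi by simp
    then show "- 1 \<le> ?\<delta> i t" using a_pos[of i] by (simp add: angle_error_def)
  qed
qed

theorem theorem4:
  fixes A :: "'n::finite \<Rightarrow> 'n \<Rightarrow> real"
    and NT :: "'n \<Rightarrow> 'm::finite set"
    and pt v :: "'m \<Rightarrow> real \<Rightarrow> real ^ 2"
    and \<beta> wd rhod ke kz kd :: real
    and a :: "'n \<Rightarrow> real"
    and succ :: "'n \<Rightarrow> 'n"
    and p1 q1 p2 q2 p3 q3 :: nat
  assumes leaders: "\<And>j t. t \<ge> 0 \<Longrightarrow> (pt j has_vector_derivative v j t) (at t within {0..})"
    and graph: "undirected_connected A"
    and observed: "\<And>j. observers NT j \<noteq> {}"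
    and \<beta>_pos: "\<beta> > 0"
    and speed: "\<And>j t. t \<ge> 0 \<Longrightarrow> norm (v j t) \<le> \<beta>"
    and pattern: "admissible_pattern pt wd rhod a"
    and gains: "ke > 0" "kz > 0" "kd > 0"
    and alpha1: "odd p1" "odd q1" "0 < q1" "q1 < p1"
    and alpha2: "odd p2" "odd q2" "0 < q2" "q2 < p2"
    and alpha3: "odd p3" "odd q3" "0 < q3" "q3 < p3"
  shows "finite_time_stable_origin
           {error_traj NT pt rhod a succ Phi p | Phi p.
              closed_loop A NT pt ke kz kd p1 q1 p2 q2 p3 q3 wd rhod a succ Phi p} \<and>
         (\<forall>Phi p. closed_loop A NT pt ke kz kd p1 q1 p2 q2 p3 q3 wd rhod a succ Phi p \<longrightarrow>
            (\<exists>T2\<ge>0. \<exists>T3\<ge>0. \<forall>i.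
               (\<forall>t>T2. \<bar>norm (p i t - estimate NT pt Phi i t) - rhod\<bar> = 0) \<and>
               (\<forall>t>T3. \<bar>included_angle succ (\<lambda>k. p k t - estimate NT pt Phi k t) i - a i\<bar> = 0)))"
proof -
  have error_dynamics: "error_dynamics succ a kz kd wd rhod (real q2 / real p2) (real q3 / real p3)
      (\<lambda>i t. radius_error rhod (\<lambda>i. p i t - estimate NT pt Phi i t) i)
      (\<lambda>i t. angle_error a succ (\<lambda>i. p i t - estimate NT pt Phi i t) i)"
    if "closed_loop A NT pt ke kz kd p1 q1 p2 q2 p3 q3 wd rhod a succ Phi p" for Phi p
    by (rule closed_loop_error_dynamics) (fact that assms)+
  let ?S = "{error_traj NT pt rhod a succ Phi p | Phi p.
      closed_loop A NT pt ke kz kd p1 q1 p2 q2 p3 q3 wd rhod a succ Phi p}"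
  have "finite_time_stable_origin ?S"
  \<comment> \<open>That the successor map is cyclic is only known through a trajectory of the closed loop.\<close>
  proof (cases "?S = {}")
    case True
    then show ?thesis unfolding finite_time_stable_origin_def by (simp only:) (auto intro: exI[of _ 1])
  next
    case False
    then obtain Phi p where
      "closed_loop A NT pt ke kz kd p1 q1 p2 q2 p3 q3 wd rhod a succ Phi p" by blast
    then interpret formation_parameters succ a kz kd wd rhod "real q2 / real p2" "real q3 / real p3"
      using error_dynamics error_dynamics.axioms(1) by blast
    show ?thesis
    proof (rule finite_time_stable_errors)
      fix x assume "x \<in> ?S"
      then obtain Phi p where x: "x = error_traj NT pt rhod a succ Phi p"
        and loop: "closed_loop A NT pt ke kz kd p1 q1 p2 q2 p3 q3 wd rhod a succ Phi p" by blast
      show "\<exists>z \<delta>. error_dynamics succ a kz kd wd rhod (real q2 / real p2) (real q3 / real p3) z \<delta> \<and>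
          (\<forall>t. x t = ((\<chi> i. z i t), (\<chi> i. \<delta> i t)))"
        using error_dynamics[OF loop] unfolding x error_traj_def Let_def by blast
    qed
  qed
  moreover have "\<exists>T2\<ge>0. \<exists>T3\<ge>0. \<forall>i.
      (\<forall>t>T2. \<bar>norm (p i t - estimate NT pt Phi i t) - rhod\<bar> = 0) \<and>
      (\<forall>t>T3. \<bar>included_angle succ (\<lambda>k. p k t - estimate NT pt Phi k t) i - a i\<bar> = 0)"
    if loop: "closed_loop A NT pt ke kz kd p1 q1 p2 q2 p3 q3 wd rhod a succ Phi p" for Phi p
  proof -
    let ?d = "\<lambda>t i. p i t - estimate NT pt Phi i t"
    interpret error_dynamics succ a kz kd wd rhod "real q2 / real p2" "real q3 / real p3"
      "\<lambda>i t. radius_error rhod (?d t) i" "\<lambda>i t. angle_error a succ (?d t) i"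
      by (rule error_dynamics[OF loop])
    obtain T where T: "T \<ge> 0"
      "\<And>t i. t \<ge> T \<Longrightarrow> radius_error rhod (?d t) i = 0 \<and> angle_error a succ (?d t) i = 0"
      using errors_vanish by blast
    have "\<bar>norm (?d t i) - rhod\<bar> = 0" "\<bar>included_angle succ (?d t) i - a i\<bar> = 0" if "t > T" for t i
      using T(2)[of t i] that a_pos[of i] by (auto simp: radius_error_def angle_error_def field_simps)
    with T(1) show ?thesis by blast
  qed
  ultimately show ?thesis by blast
qed

end
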